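(* Let $X$ be a finite cell complex, $q$ a prime integer, $i$ a non-negative integer, and $p_2,p_1\in[0,1]$. Let $\rho_{p_2,p_1}=\rho_{p_2,p_1,q,i,X}$ be the coupled plaquette percolation. Then $\rho_{p_2,p_1}$ is stochastically dominated by independent Bernoulli percolation with probability $p_2$ on $(i+1)$-cells and probability $p_1$ on $i$-cells, and $\rho_{p_2,p_1}$ stochastically dominates independent Bernoulli percolation with probability $\frac{p_2}{q(1-p_2)+p_2}$ on $(i+1)$-cells and probability $\frac{p_1}{q(1-p_1)+p_1}$ on $i$-cells. Furthermore, when $q$ is fixed, $\rho_{p_2,p_1}$ is stochastically increasing in $p_2$ and in $p_1$.
   Context: For a cell complex $X$: $X^{[j]}$ is the set of $j$-cells and $X^{(j)}$ the $j$-skeleton. $C^j(X;\mathbb{Z}_q)$ is the group of functions $f$ from oriented $j$-cells to $\mathbb{Z}_q$ (integers modulo $q$) with $f(-x)=-f(x)$; $\delta f(x)=f(\partial x)$ with $\partial$ the cellular boundary. A $j$-dimensional percolation subcomplex of $X$ is a subcomplex $P$ with $X^{(j-1)}\subseteq P\subseteq X^{(j)}$; $|P|$ is its number of $j$-cells. It is identified with the binary assignment on $j$-cells with $P(x)=1$ iff $x\in P$; a pair $(P_2,P_1)$ is thus a binary assignment on $X^{[i+1]}\cup X^{[i]}$. The coupled plaquette percolation $\rho_{p_2,p_1,q,i,X}$ is the probability measure on pairs $(P_2,P_1)$ of percolation subcomplexes of $X$ of dimensions $i+1$ and $i$ with $$\rho(P_2,P_1)\propto p_2^{|P_2|}(1-p_2)^{|X^{[i+1]}|-|P_2|}\,p_1^{|P_1|}(1-p_1)^{|X^{[i]}|-|P_1|}\,|H^i(P_2,P_1;\mathbb{Z}_q)|,$$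 where the relative cohomology $H^i(P_2,P_1;\mathbb{Z}_q)$ coincides with the group of $f\in C^i(X;\mathbb{Z}_q)$ such that $f(\epsilon)=0$ for all $i$-cells $\epsilon$ of $P_1$ and $\delta f(\sigma)=0$ for all $(i+1)$-cells $\sigma$ of $P_2$. For binary assignments, $\omega_1\le\omega_2$ means $\omega_1(z)=1$ implies $\omega_2(z)=1$ for all $z$. A measure $\pi_2$ stochastically dominates $\pi_1$ if there is a coupling $K$ of $\pi_1$ and $\pi_2$ with $K(\omega_1\le\omega_2)=1$. *)

theory Defs
  imports
    "HOL-Probability.Probability"
    "HOL-Homology.Homology"
    "HOL-Number_Theory.Residues"
begin

section \<open>Finite cell complexes\<close>

text \<open>
  Discs live in the same coordinates as the library's spheres: the boundary of
  \<^term>\<open>disc (Suc n)\<close> is \<^term>\<open>nsphere n\<close>, and \<^term>\<open>disc 0\<close> is a point with empty boundary.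
\<close>

definition disc :: "nat \<Rightarrow> (nat \<Rightarrow> real) topology" where
  "disc n = subtopology (Euclidean_space n) {u. (\<Sum>k<n. (u k)\<^sup>2) \<le> 1}"

definition open_disc :: "nat \<Rightarrow> (nat \<Rightarrow> real) set" where
  "open_disc n = {u \<in> topspace (disc n). (\<Sum>k<n. (u k)\<^sup>2) < 1}"

text \<open>
  Cells are given by indices \<^typ>\<open>'c\<close>; \<open>char_map X c\<close> is the characteristic map of the cell \<open>c\<close>.
\<close>

record ('a, 'c) cell_complex =
  total_space :: "'a topology"
  cells :: "'c set"
  cell_dim :: "'c \<Rightarrow> nat"
  char_map :: "'c \<Rightarrow> (nat \<Rightarrow> real) \<Rightarrow> 'a"

definition open_cell :: "('a, 'c) cell_complex \<Rightarrow> 'c \<Rightarrow> 'a set" where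
  "open_cell X c = char_map X c ` open_disc (cell_dim X c)"

definition closed_cell :: "('a, 'c) cell_complex \<Rightarrow> 'c \<Rightarrow> 'a set" where
  "closed_cell X c = char_map X c ` topspace (disc (cell_dim X c))"

text \<open>
  Finite CW complexes. As there are finitely many cells and the space is Hausdorff, closure
  finiteness, the weak topology, and the fact that characteristic maps restrict to homeomorphisms
  from open discs onto open cells are consequences and need not be required.
\<close>

definition finite_cell_complex :: "('a, 'c) cell_complex \<Rightarrow> bool" where
  "finite_cell_complex X \<longleftrightarrow>
     Hausdorff_space (total_space X) \<and>
     finite (cells X) \<and>
     (\<forall>c\<in>cells X. continuous_map (disc (cell_dim X c)) (total_space X) (char_map X c)) \<and>
     (\<forall>c\<in>cells X. inj_on (char_map X c) (open_disc (cell_dim X c))) \<and>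
     disjoint_family_on (open_cell X) (cells X) \<and>
     (\<Union>c\<in>cells X. open_cell X c) = topspace (total_space X) \<and>
     (\<forall>c\<in>cells X. char_map X c ` (topspace (disc (cell_dim X c)) - open_disc (cell_dim X c))
        \<subseteq> (\<Union>d\<in>{d \<in> cells X. cell_dim X d < cell_dim X c}. open_cell X d))"

text \<open>Subcomplexes are represented by their sets of cells.\<close>

definition subcomplex :: "('a, 'c) cell_complex \<Rightarrow> 'c set \<Rightarrow> bool" where
  "subcomplex X A \<longleftrightarrow>
     A \<subseteq> cells X \<and> (\<forall>c\<in>A. closed_cell X c \<subseteq> (\<Union>d\<in>A. open_cell X d))"

definition cells_of :: "('a, 'c) cell_complex \<Rightarrow> 'c set \<Rightarrow> nat \<Rightarrow> 'c set" where
  "cells_of X A j = {c \<in> A. cell_dim X c = j}"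

text \<open>The skeleton is indexed by integers so that the (-1)-skeleton is empty.\<close>

definition skeleton :: "('a, 'c) cell_complex \<Rightarrow> int \<Rightarrow> 'c set" where
  "skeleton X j = {c \<in> cells X. int (cell_dim X c) \<le> j}"


section \<open>Cellular boundary\<close>

text \<open>
  \<open>disc_to_sphere n\<close> collapses the boundary of the \<open>n\<close>-disc to the basepoint
  \<open>(0, \<dots>, 0, -1)\<close> of the \<open>n\<close>-sphere and is injective on the open disc. For \<open>n = 0\<close> it
  sends the point to \<open>1\<close>.
\<close>

definition sphere_basepoint :: "nat \<Rightarrow> nat \<Rightarrow> real" where
  "sphere_basepoint n = (\<lambda>k. if k = n then -1 else 0)"

definition disc_to_sphere :: "nat \<Rightarrow> (nat \<Rightarrow> real) \<Rightarrow> nat \<Rightarrow> real" where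
  "disc_to_sphere n u =
     (let r2 = (\<Sum>k<n. (u k)\<^sup>2)
      in (\<lambda>k. if k < n then 2 * sqrt (1 - r2) * u k
              else if k = n then 1 - 2 * r2
              else 0))"

text \<open>
  For an \<open>n\<close>-cell \<open>c\<close>, the map from the \<open>n\<close>-skeleton to the \<open>n\<close>-sphere that collapses the
  complement of the open cell \<open>c\<close> to the basepoint.
\<close>

definition collapse_to_sphere :: "('a, 'c) cell_complex \<Rightarrow> 'c \<Rightarrow> 'a \<Rightarrow> nat \<Rightarrow> real" where
  "collapse_to_sphere X c x =
     (if x \<in> open_cell X c
      then disc_to_sphere (cell_dim X c)
             (inv_into (open_disc (cell_dim X c)) (char_map X c) x)
      else sphere_basepoint (cell_dim X c))"

text \<open>
  The coefficient of the \<open>n\<close>-cell \<open>c\<close> in the cellular boundary of the \<open>(n+1)\<close>-cell \<open>s\<close>, both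
  oriented by their characteristic maps: the degree of the attaching map of \<open>s\<close> followed by the
  collapse onto \<open>c\<close>. For an edge this gives (end vertex) - (start vertex). The orientation of
  \<^const>\<open>disc_to_sphere\<close> only affects the cellular boundary by a global sign in each dimension.
\<close>

definition incidence :: "('a, 'c) cell_complex \<Rightarrow> 'c \<Rightarrow> 'c \<Rightarrow> int" where
  "incidence X s c =
     Brouwer_degree2 (cell_dim X c) (\<lambda>u. collapse_to_sphere X c (char_map X s u))"


section \<open>Cellular cochains and relative cohomology\<close>

text \<open>
  The oriented cell \<open>(c, True)\<close> carries the orientation of its characteristic map, and
  \<open>(c, False)\<close> is \<open>-(c, True)\<close>.
\<close>

definition oriented_cells :: "('a, 'c) cell_complex \<Rightarrow> 'c set \<Rightarrow> nat \<Rightarrow> ('c \<times> bool) set" where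
  "oriented_cells X A j = cells_of X A j \<times> UNIV"

definition orientation_sign :: "bool \<Rightarrow> int" where
  "orientation_sign e = (if e then 1 else -1)"

abbreviation Z_mod :: "nat \<Rightarrow> int ring" where
  "Z_mod q \<equiv> residue_ring (int q)"

text \<open>
  The relative cochain group \<open>C\<^sup>j(A, B; Z\<^sub>q)\<close> of a pair of subcomplexes; \<open>B = {}\<close> gives
  \<open>C\<^sup>j(A; Z\<^sub>q)\<close>.
\<close>

definition cochain_group ::
  "('a, 'c) cell_complex \<Rightarrow> nat \<Rightarrow> 'c set \<Rightarrow> 'c set \<Rightarrow> nat \<Rightarrow> ('c \<times> bool \<Rightarrow> int) monoid" where
  "cochain_group X q A B j =
     \<lparr>carrier = {f \<in> oriented_cells X A j \<rightarrow>\<^sub>E carrier (Z_mod q).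
                   (\<forall>(c, e) \<in> oriented_cells X A j. f (c, \<not> e) = \<ominus>\<^bsub>Z_mod q\<^esub> f (c, e)) \<and>
                   (\<forall>x \<in> oriented_cells X B j. f x = \<zero>\<^bsub>Z_mod q\<^esub>)},
      monoid.mult = (\<lambda>f g. \<lambda>x\<in>oriented_cells X A j. f x \<oplus>\<^bsub>Z_mod q\<^esub> g x),
      one = (\<lambda>x\<in>oriented_cells X A j. \<zero>\<^bsub>Z_mod q\<^esub>)\<rparr>"

text \<open>\<open>(\<delta>f)(x) = f(\<partial>x)\<close>, with \<open>f\<close> extended linearly to integral chains.\<close>

definition coboundary ::
  "('a, 'c) cell_complex \<Rightarrow> nat \<Rightarrow> 'c set \<Rightarrow> nat \<Rightarrow> ('c \<times> bool \<Rightarrow> int) \<Rightarrow> 'c \<times> bool \<Rightarrow> int" where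
  "coboundary X q A j f =
     (\<lambda>(s, e)\<in>oriented_cells X A (Suc j).
        \<Oplus>\<^bsub>Z_mod q\<^esub>c\<in>cells_of X A j. [(orientation_sign e * incidence X s c)] \<cdot>\<^bsub>Z_mod q\<^esub> f (c, True))"

definition cocycles ::
  "('a, 'c) cell_complex \<Rightarrow> nat \<Rightarrow> 'c set \<Rightarrow> 'c set \<Rightarrow> nat \<Rightarrow> ('c \<times> bool \<Rightarrow> int) set" where
  "cocycles X q A B j =
     {f \<in> carrier (cochain_group X q A B j).
        coboundary X q A j f = \<one>\<^bsub>cochain_group X q A B (Suc j)\<^esub>}"

text \<open>In degree 0 there are no cochains of degree -1, hence only the trivial coboundary.\<close>

definition coboundaries ::
  "('a, 'c) cell_complex \<Rightarrow> nat \<Rightarrow> 'c set \<Rightarrow> 'c set \<Rightarrow> nat \<Rightarrow> ('c \<times> bool \<Rightarrow> int) set" where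
  "coboundaries X q A B j =
     (case j of
        0 \<Rightarrow> {\<one>\<^bsub>cochain_group X q A B 0\<^esub>}
      | Suc k \<Rightarrow> coboundary X q A k ` carrier (cochain_group X q A B k))"

definition relative_cohomology ::
  "('a, 'c) cell_complex \<Rightarrow> nat \<Rightarrow> 'c set \<Rightarrow> 'c set \<Rightarrow> nat \<Rightarrow> ('c \<times> bool \<Rightarrow> int) set monoid" where
  "relative_cohomology X q A B j =
     (cochain_group X q A B j)\<lparr>carrier := cocycles X q A B j\<rparr> Mod coboundaries X q A B j"


section \<open>Coupled plaquette percolation\<close>

definition percolation_subcomplex :: "('a, 'c) cell_complex \<Rightarrow> nat \<Rightarrow> 'c set \<Rightarrow> bool" where
  "percolation_subcomplex X j P \<longleftrightarrow>
     subcomplex X P \<and> skeleton X (int j - 1) \<subseteq> P \<and> P \<subseteq> skeleton X (int j)"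

definition percolation_pairs :: "('a, 'c) cell_complex \<Rightarrow> nat \<Rightarrow> ('c set \<times> 'c set) set" where
  "percolation_pairs X i =
     {(P2, P1). percolation_subcomplex X (Suc i) P2 \<and> percolation_subcomplex X i P1}"

definition bernoulli_weight :: "('a, 'c) cell_complex \<Rightarrow> nat \<Rightarrow> real \<Rightarrow> 'c set \<Rightarrow> real" where
  "bernoulli_weight X j p P =
     p ^ card (cells_of X P j) *
     (1 - p) ^ (card (cells_of X (cells X) j) - card (cells_of X P j))"

definition coupled_weight ::
  "('a, 'c) cell_complex \<Rightarrow> nat \<Rightarrow> nat \<Rightarrow> real \<Rightarrow> real \<Rightarrow> 'c set \<times> 'c set \<Rightarrow> real" where
  "coupled_weight X q i p2 p1 = (\<lambda>(P2, P1).
     bernoulli_weight X (Suc i) p2 P2 * bernoulli_weight X i p1 P1 *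
     real (order (relative_cohomology X q P2 P1 i)))"

definition coupled_percolation_pairs ::
  "('a, 'c) cell_complex \<Rightarrow> nat \<Rightarrow> nat \<Rightarrow> real \<Rightarrow> real \<Rightarrow> ('c set \<times> 'c set) pmf" where
  "coupled_percolation_pairs X q i p2 p1 =
     embed_pmf (\<lambda>P. if P \<in> percolation_pairs X i
                    then coupled_weight X q i p2 p1 P /
                         (\<Sum>Q\<in>percolation_pairs X i. coupled_weight X q i p2 p1 Q)
                    else 0)"

text \<open>
  Binary assignments on the \<open>(i+1)\<close>- and \<open>i\<close>-cells are functions \<^typ>\<open>'c \<Rightarrow> bool\<close> that are
  \<^const>\<open>False\<close> on all other indices. Note that a subcomplex \<open>P2\<close> always contains all
  \<open>i\<close>-cells; only its \<open>(i+1)\<close>-cells are recorded.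
\<close>

definition assignment_of :: "('a, 'c) cell_complex \<Rightarrow> nat \<Rightarrow> 'c set \<times> 'c set \<Rightarrow> 'c \<Rightarrow> bool" where
  "assignment_of X i = (\<lambda>(P2, P1) c.
     c \<in> cells_of X P2 (Suc i) \<or> c \<in> cells_of X P1 i)"

definition coupled_percolation ::
  "('a, 'c) cell_complex \<Rightarrow> nat \<Rightarrow> nat \<Rightarrow> real \<Rightarrow> real \<Rightarrow> ('c \<Rightarrow> bool) pmf" where
  "coupled_percolation X q i p2 p1 =
     map_pmf (assignment_of X i) (coupled_percolation_pairs X q i p2 p1)"

definition bernoulli_percolation ::
  "('a, 'c) cell_complex \<Rightarrow> nat \<Rightarrow> real \<Rightarrow> real \<Rightarrow> ('c \<Rightarrow> bool) pmf" where
  "bernoulli_percolation X i p2 p1 =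
     Pi_pmf (cells_of X (cells X) (Suc i) \<union> cells_of X (cells X) i) False
       (\<lambda>c. bernoulli_pmf (if cell_dim X c = Suc i then p2 else p1))"

text \<open>\<open>stochastically_dominates M2 M1\<close>: \<open>M2\<close> dominates \<open>M1\<close>.\<close>

definition stochastically_dominates ::
  "('c \<Rightarrow> bool) pmf \<Rightarrow> ('c \<Rightarrow> bool) pmf \<Rightarrow> bool" where
  "stochastically_dominates M2 M1 \<longleftrightarrow>
     (\<exists>K :: (('c \<Rightarrow> bool) \<times> ('c \<Rightarrow> bool)) pmf.
        map_pmf fst K = M1 \<and> map_pmf snd K = M2 \<and>
        measure_pmf.prob K {(w1, w2). \<forall>z. w1 z \<longrightarrow> w2 z} = 1)"

end

theory Submission
  imports Defs
begin

text \<open>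
  Write \<open>w\<close> for a set of open cells of dimension \<open>i + 1\<close> and \<open>i\<close>, and \<open>n w\<close> for the number of
  \<open>i\<close>-cochains satisfying the constraints that the cells of \<open>w\<close> impose: an \<open>i\<close>-cell asks that the
  cochain vanish on it, an \<open>(i + 1)\<close>-cell that the coboundary vanish on it. The order of the
  relative cohomology is \<open>n w\<close>, because every cell of dimension below \<open>i\<close> lies in the
  \<open>i\<close>-dimensional subcomplex, so that there are no nonzero relative coboundaries
  (\<open>coboundaries_percolation_pair\<close>, \<open>card_cocycles\<close>). The coupled percolation is therefore
  independent Bernoulli percolation reweighted by \<open>n\<close> (\<open>pmf_coupled_percolation\<close>).

  As \<open>n w\<close> counts the common zeros of a family of homomorphisms to the integers modulo \<open>q\<close>, one
  for each cell of \<open>w\<close>, it decreases in \<open>w\<close>; each additional cell divides it by at most \<open>q\<close>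
  (\<open>card_modular_solutions_union\<close>); and it is log-supermodular, since two subgroups of a finite
  abelian group satisfy \<open>|H| |K| = |H + K| |H \<inter> K|\<close>
  (\<open>card_modular_solutions_supermodular\<close>).

  Each of the three comparisons is now an instance of Holley's criterion (\<open>Holley\<close>): if
  \<open>M\<^sub>1(a) M\<^sub>2(b) \<le> M\<^sub>1(a \<inter> b) M\<^sub>2(a \<union> b)\<close> for all \<open>a\<close> and \<open>b\<close>, then \<open>M\<^sub>2\<close> dominates \<open>M\<^sub>1\<close>.
  For the upper bound one uses that \<open>n\<close> decreases, for monotonicity in the probabilities that \<open>n\<close>
  is log-supermodular. For the lower bound the loss of a factor \<open>q\<close> for every cell of \<open>a - b\<close> is
  paid for by the reduced probability \<open>r = p / (q (1 - p) + p)\<close>, whose odds are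
  \<open>r / (1 - r) = p / (q (1 - p))\<close>. The criterion is proved by building the coupling one
  cell at a time, which, unlike an argument through a Markov chain, works for probabilities
  0 and 1 as well.
\<close>

section \<open>Holley's criterion\<close>

lemma stochastically_dominates_iff_rel_pmf:
  "stochastically_dominates M2 M1 \<longleftrightarrow> rel_pmf (\<le>) M1 M2"
proof -
  have "measure_pmf.prob K {(w1, w2). \<forall>z. w1 z \<longrightarrow> w2 z} = 1 \<longleftrightarrow> (\<forall>(v, w)\<in>set_pmf K. v \<le> w)"
    for K :: "(('c \<Rightarrow> bool) \<times> ('c \<Rightarrow> bool)) pmf"
    by (auto simp: measure_pmf.prob_eq_1 AE_measure_pmf_iff le_fun_def)
  note prob_eq_1_iff = this
  show ?thesis
    unfolding stochastically_dominates_def prob_eq_1_iff rel_pmf.simps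
    by (rule iffI; elim exE conjE; hypsubst?; intro exI conjI allI impI; (assumption | rule refl)?; force)
qed

text \<open>
  Let \<open>X\<close> and \<open>Y\<close> be independent with parameters \<open>r / s\<close> and \<open>s\<close>. Then \<open>X \<and> Y\<close> has parameter
  \<open>r\<close> and implies \<open>Y\<close>, so \<open>(X \<and> Y, Y)\<close> is the required coupling.
\<close>

lemma rel_pmf_bernoulli_mono:
  assumes "0 \<le> r" "r \<le> s" "s \<le> 1"
  shows "rel_pmf (\<le>) (bernoulli_pmf r) (bernoulli_pmf s)"
proof -
  define J where "J = pair_pmf (bernoulli_pmf (r / s)) (bernoulli_pmf s)"
  have "r / s \<le> 1" "0 \<le> r / s" "s = 0 \<longrightarrow> r = 0"
    using assms by (auto simp: divide_le_eq_1)
  moreover have "(\<lambda>(x, y). x \<and> y) -` {True} = {(True, True)}"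
    by auto
  ultimately have "pmf (map_pmf (\<lambda>(x, y). x \<and> y) J) True = pmf (bernoulli_pmf r) True"
    using assms by (simp add: J_def pmf_map measure_pmf_single pmf_pair)
  then have "pmf (map_pmf (\<lambda>(x, y). x \<and> y) J) t = pmf (bernoulli_pmf r) t" for t
    by (cases t) (simp_all add: pmf_False_conv_True)
  then have "bernoulli_pmf r = map_pmf (\<lambda>(x, y). x \<and> y) J"
    by (intro pmf_eqI) simp
  moreover have "bernoulli_pmf s = map_pmf snd J"
    by (simp add: J_def map_snd_pair_pmf)
  moreover have "rel_pmf (\<le>) (map_pmf (\<lambda>(x, y). x \<and> y) J) (map_pmf snd J)"
    unfolding pmf.rel_map by (rule rel_pmf_reflI) auto
  ultimately show ?thesis by simp
qed

text \<open>
  The one-coordinate case of the four functions theorem; it makes Holley's hypothesis survive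
  summation over one coordinate. Only the mixed terms \<open>u = a0 b1\<close> and \<open>v = a1 b0\<close> need care:
  both are at most \<open>P = c0 d1\<close>, while their product is at most \<open>P Q\<close> with \<open>Q = c1 d0\<close>, so
  \<open>(P - u) (P - v) \<ge> 0\<close> gives \<open>u + v \<le> P + Q\<close>.
\<close>

lemma four_point_inequality:
  fixes a0 a1 b0 b1 c0 c1 d0 d1 :: real
  assumes nonneg: "0 \<le> a0" "0 \<le> a1" "0 \<le> b0" "0 \<le> b1" "0 \<le> c0" "0 \<le> c1" "0 \<le> d0" "0 \<le> d1"
    and le: "a0 * b0 \<le> c0 * d0" "a0 * b1 \<le> c0 * d1" "a1 * b0 \<le> c0 * d1" "a1 * b1 \<le> c1 * d1"
  shows "(a0 + a1) * (b0 + b1) \<le> (c0 + c1) * (d0 + d1)"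
proof -
  define P Q u v where "P = c0 * d1" and "Q = c1 * d0" and "u = a0 * b1" and "v = a1 * b0"
  have "u + v \<le> P + Q"
  proof (cases "P = 0")
    case True
    then have "u + v \<le> 0"
      using le(2,3) unfolding P_def u_def v_def by linarith
    moreover have "0 \<le> Q"
      using nonneg by (simp add: Q_def)
    ultimately show ?thesis
      using True by simp
  next
    case False
    have pos: "P > 0" using False nonneg by (simp add: P_def)
    have "u * v = (a0 * b0) * (a1 * b1)" by (simp add: u_def v_def)
    also have "\<dots> \<le> (c0 * d0) * (c1 * d1)"
      by (rule mult_mono[OF le(1,4)]) (use nonneg in auto)
    also have "\<dots> = P * Q" by (simp add: P_def Q_def)
    finally have "u * v \<le> P * Q" .
    moreover have "0 \<le> (P - u) * (P - v)"
      using le by (simp add: P_def u_def v_def)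
    ultimately have "P * (u + v) \<le> P * (P + Q)"
      by (simp add: algebra_simps)
    then show ?thesis using pos by simp
  qed
  then show ?thesis
    using le by (simp add: P_def Q_def u_def v_def algebra_simps)
qed

text \<open>
  The conditional law of coordinate \<open>z\<close> given that all other coordinates agree with \<open>a\<close>. If that
  event has probability zero, the quotient is \<open>0 / 0 = 0\<close>.
\<close>

definition site_conditional where
  "site_conditional z M a = (let t = pmf M (a(z := True)) in bernoulli_pmf (t / (pmf M (a(z := False)) + t)))"

lemma pmf_forget_site:
  "pmf (map_pmf (\<lambda>w. w(z := False)) M) a =
     (if a z then 0 else pmf M (a(z := False)) + pmf M (a(z := True)))"
proof (cases "a z")
  case True
  then show ?thesis
    by (auto simp: pmf_eq_0_set_pmf fun_eq_iff)
next
  case False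
  have "(\<lambda>w. w(z := False)) -` {a} = {a(z := False), a(z := True)}"
    using False by (auto simp: fun_eq_iff split: if_splits)
  moreover have "a(z := False) \<noteq> a(z := True)" by (auto simp: fun_eq_iff)
  ultimately show ?thesis
    using False by (simp add: pmf_map measure_measure_pmf_finite)
qed

lemma bind_site_conditional:
  fixes M :: "('c \<Rightarrow> bool) pmf" and z :: 'c
  defines "N \<equiv> map_pmf (\<lambda>w. w(z := False)) M"
  shows "bind_pmf N (\<lambda>a. map_pmf (\<lambda>t. a(z := t)) (site_conditional z M a)) = M"
proof (rule pmf_eqI)
  fix w
  define a where "a = w(z := False)"
  define s where "s = pmf M (a(z := False)) + pmf M (a(z := True))"
  have Na: "pmf N a = s" by (simp add: N_def pmf_forget_site a_def s_def)
  have step: "pmf (map_pmf (\<lambda>t. b(z := t)) (site_conditional z M b)) w =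
     indicator {a} b * pmf (site_conditional z M a) (w z)" if "b \<in> set_pmf N" for b
  proof (cases "b = a")
    case True
    have "inj (\<lambda>t. b(z := t))" by (rule injI) (metis fun_upd_same)
    moreover have "w = b(z := w z)" using True by (auto simp: a_def)
    ultimately show ?thesis
      using pmf_map_inj'[of "\<lambda>t. b(z := t)" "site_conditional z M b" "w z"] True by simp
  next
    case False
    have "\<not> b z" using that by (auto simp: N_def)
    then have "w \<noteq> b(z := t)" for t
      using False fun_upd_idem[of b z False] by (auto simp: a_def)
    then have "pmf (map_pmf (\<lambda>t. b(z := t)) (site_conditional z M b)) w = 0"
      by (auto simp: pmf_eq_0_set_pmf)
    then show ?thesis using False by simp
  qed
  have "pmf (bind_pmf N (\<lambda>b. map_pmf (\<lambda>t. b(z := t)) (site_conditional z M b))) w =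
      measure_pmf.expectation N (\<lambda>b. indicator {a} b * pmf (site_conditional z M a) (w z))"
    unfolding pmf_bind by (intro integral_cong_AE) (auto simp: AE_measure_pmf_iff step)
  also have "\<dots> = s * pmf (site_conditional z M a) (w z)"
    by (simp add: measure_pmf_single Na)
  also have "\<dots> = pmf M (a(z := w z))"
  proof (cases "s = 0")
    case True
    then have "pmf M (a(z := False)) = 0" "pmf M (a(z := True)) = 0"
      using pmf_nonneg[of M "a(z := False)"] pmf_nonneg[of M "a(z := True)"]
      unfolding s_def by linarith+
    then show ?thesis using True by (cases "w z") auto
  next
    case False
    then have "s > 0" by (simp add: s_def order_less_le)
    moreover have "pmf M (a(z := True)) / s \<le> 1" "0 \<le> pmf M (a(z := True)) / s"
      using \<open>s > 0\<close> by (auto simp: s_def divide_le_eq_1)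
    ultimately show ?thesis
      by (cases "w z") (simp_all add: site_conditional_def Let_def s_def[symmetric] field_simps, simp add: s_def algebra_simps)
  qed
  also have "a(z := w z) = w" by (simp add: a_def)
  finally show "pmf (bind_pmf N (\<lambda>b. map_pmf (\<lambda>t. b(z := t)) (site_conditional z M b))) w = pmf M w" .
qed

text \<open>
  Induction on the set of sites. Forgetting the site \<open>z\<close> preserves the hypothesis by
  \<open>four_point_inequality\<close>, so the marginals have a monotone coupling. For coupled \<open>a \<le> b\<close> the hypothesis at
  \<open>a(z := True)\<close> and \<open>b(z := False)\<close> says that the conditional probability of \<open>z\<close> under \<open>M1\<close>
  given \<open>a\<close> is at most the one under \<open>M2\<close> given \<open>b\<close>; so the coupling extends to \<open>z\<close>.
\<close>

lemma Holley:
  fixes M1 M2 :: "('c \<Rightarrow> bool) pmf"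
  assumes "finite S"
    and "\<And>w. w \<in> set_pmf M1 \<union> set_pmf M2 \<Longrightarrow> {z. w z} \<subseteq> S"
    and "\<And>a b. pmf M1 a * pmf M2 b \<le> pmf M1 (inf a b) * pmf M2 (sup a b)"
  shows "rel_pmf (\<le>) M1 M2"
  using assms
proof (induction S arbitrary: M1 M2 rule: finite_induct)
  case empty
  have "w = (\<lambda>_. False)" if "w \<in> set_pmf M1 \<union> set_pmf M2" for w
    using empty(1)[OF that] by auto
  then have "M1 = return_pmf (\<lambda>_. False)" "M2 = return_pmf (\<lambda>_. False)"
    by (auto intro!: set_pmf_subset_singleton[THEN iffD1])
  then show ?case by simp
next
  case (insert z S)
  define N where "N M = map_pmf (\<lambda>w. w(z := False)) M" for M :: "('c \<Rightarrow> bool) pmf"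
  have "rel_pmf (\<le>) (N M1) (N M2)"
  proof (rule insert.IH)
    show "{y. w y} \<subseteq> S" if "w \<in> set_pmf (N M1) \<union> set_pmf (N M2)" for w
    proof -
      obtain v where "v \<in> set_pmf M1 \<union> set_pmf M2" "w = v(z := False)"
        using \<open>w \<in> _\<close> by (auto simp: N_def)
      then show ?thesis
        using insert.prems(1)[of v] by auto
    qed
    show "pmf (N M1) a * pmf (N M2) b \<le> pmf (N M1) (inf a b) * pmf (N M2) (sup a b)" for a b
    proof (cases "a z \<or> b z")
      case True
      then show ?thesis by (auto simp: N_def pmf_forget_site)
    next
      case False
      have eqs: "inf (a(z := s)) (b(z := t)) = (inf a b)(z := s \<and> t)"
        "sup (a(z := s)) (b(z := t)) = (sup a b)(z := s \<or> t)" for s t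
        by (auto simp: fun_eq_iff)
      have "pmf M1 (a(z := s)) * pmf M2 (b(z := t)) \<le>
          pmf M1 ((inf a b)(z := s \<and> t)) * pmf M2 ((sup a b)(z := s \<or> t))" for s t
        using insert.prems(2)[of "a(z := s)" "b(z := t)"] unfolding eqs .
      from this[of False False] this[of False True] this[of True False] this[of True True]
      show ?thesis
        using False by (simp add: N_def pmf_forget_site four_point_inequality)
    qed
  qed
  \<comment> \<open>Restricting to the supports keeps the denominators of the conditional laws positive.\<close>
  then have "rel_pmf (\<lambda>a b. a \<in> set_pmf (N M1) \<and> b \<in> set_pmf (N M2) \<and> a \<le> b) (N M1) (N M2)"
    by (rule pmf.rel_mono_strong) auto
  then have "rel_pmf (\<le>) (bind_pmf (N M1) (\<lambda>a. map_pmf (\<lambda>t. a(z := t)) (site_conditional z M1 a)))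
     (bind_pmf (N M2) (\<lambda>b. map_pmf (\<lambda>t. b(z := t)) (site_conditional z M2 b)))"
  proof (rule rel_pmf_bindI)
    fix a b assume ab: "a \<in> set_pmf (N M1) \<and> b \<in> set_pmf (N M2) \<and> a \<le> b"
    define s where "s = pmf M1 (a(z := False)) + pmf M1 (a(z := True))"
    define t where "t = pmf M2 (b(z := False)) + pmf M2 (b(z := True))"
    have "\<not> a z" "\<not> b z" using ab by (auto simp: N_def)
    then have "s > 0" "t > 0"
      using ab pmf_positive[of a "N M1"] pmf_positive[of b "N M2"]
      by (auto simp: N_def pmf_forget_site s_def t_def)
    have eqs: "inf (a(z := True)) (b(z := False)) = a(z := False)"
      "sup (a(z := True)) (b(z := False)) = b(z := True)"
      using ab by (auto simp: fun_eq_iff le_fun_def)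
    have "pmf M1 (a(z := True)) * pmf M2 (b(z := False)) \<le>
        pmf M1 (a(z := False)) * pmf M2 (b(z := True))"
      using insert.prems(2)[of "a(z := True)" "b(z := False)"] unfolding eqs .
    then have "pmf M1 (a(z := True)) / s \<le> pmf M2 (b(z := True)) / t"
      using \<open>s > 0\<close> \<open>t > 0\<close> by (simp add: divide_simps) (simp add: s_def t_def algebra_simps)
    moreover have "pmf M2 (b(z := True)) / t \<le> 1" "0 \<le> pmf M1 (a(z := True)) / s"
      using \<open>s > 0\<close> \<open>t > 0\<close> by (auto simp: t_def divide_le_eq_1)
    ultimately have "rel_pmf (\<le>) (site_conditional z M1 a) (site_conditional z M2 b)"
      by (simp add: site_conditional_def Let_def s_def t_def rel_pmf_bernoulli_mono)
    then show "rel_pmf (\<le>) (map_pmf (\<lambda>t. a(z := t)) (site_conditional z M1 a))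
        (map_pmf (\<lambda>t. b(z := t)) (site_conditional z M2 b))"
      unfolding pmf.rel_map
      by (rule pmf.rel_mono_strong) (use ab in \<open>auto simp: le_fun_def\<close>)
  qed
  then show ?case by (simp add: N_def bind_site_conditional)
qed

section \<open>Bernoulli product measures on a lattice\<close>

text \<open>
  The inequality factorises over the sites, and only a site in \<open>a\<close> but not in \<open>b\<close> changes its
  factor, from \<open>r (1 - s)\<close> to \<open>(1 - r) s\<close>. The constant \<open>c\<close> measures the gap between the odds of
  \<open>r\<close> and of \<open>s\<close>; it is what pays for a density that changes by a factor of up to \<open>c\<close> per site.
\<close>

lemma pmf_Pi_bernoulli_lattice:
  fixes S :: "'c set" and r s :: "'c \<Rightarrow> real" and c :: real
  defines "B \<equiv> Pi_pmf S False (\<lambda>z. bernoulli_pmf (r z))"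
    and "B' \<equiv> Pi_pmf S False (\<lambda>z. bernoulli_pmf (s z))"
  assumes S: "finite S" and "0 \<le> c"
    and r: "\<And>z. z \<in> S \<Longrightarrow> r z \<in> {0..1}" and s: "\<And>z. z \<in> S \<Longrightarrow> s z \<in> {0..1}"
    and odds: "\<And>z. z \<in> S \<Longrightarrow> c * (r z * (1 - s z)) \<le> (1 - r z) * s z"
  shows "c ^ card {z \<in> S. a z \<and> \<not> b z} * (pmf B a * pmf B' b) \<le> pmf B (inf a b) * pmf B' (sup a b)"
proof (cases "\<forall>z. z \<notin> S \<longrightarrow> \<not> a z \<and> \<not> b z")
  case False
  then have "pmf B a * pmf B' b = 0"
    using S by (auto simp: B_def B'_def pmf_Pi)
  then show ?thesis by (simp only: mult_zero_right mult_nonneg_nonneg pmf_nonneg)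
next
  case True
  have "c ^ card {z \<in> S. a z \<and> \<not> b z} = (\<Prod>z\<in>S. if a z \<and> \<not> b z then c else 1)"
    using S by (simp add: prod.If_cases Int_def conj_commute)
  moreover have "pmf B a = (\<Prod>z\<in>S. if a z then r z else 1 - r z)"
    "pmf B (inf a b) = (\<Prod>z\<in>S. if a z \<and> b z then r z else 1 - r z)"
    "pmf B' b = (\<Prod>z\<in>S. if b z then s z else 1 - s z)"
    "pmf B' (sup a b) = (\<Prod>z\<in>S. if a z \<or> b z then s z else 1 - s z)"
    using True S r s by (auto simp: B_def B'_def pmf_Pi intro!: prod.cong)
  moreover have "(\<Prod>z\<in>S. (if a z \<and> \<not> b z then c else 1) *
        ((if a z then r z else 1 - r z) * (if b z then s z else 1 - s z))) \<le>
      (\<Prod>z\<in>S. (if a z \<and> b z then r z else 1 - r z) * (if a z \<or> b z then s z else 1 - s z))"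
  proof (intro prod_mono conjI)
    fix z assume "z \<in> S"
    then show "0 \<le> (if a z \<and> \<not> b z then c else 1) *
        ((if a z then r z else 1 - r z) * (if b z then s z else 1 - s z))"
      using r s \<open>0 \<le> c\<close> by (auto intro!: mult_nonneg_nonneg)
    show "(if a z \<and> \<not> b z then c else 1) *
        ((if a z then r z else 1 - r z) * (if b z then s z else 1 - s z)) \<le>
      (if a z \<and> b z then r z else 1 - r z) * (if a z \<or> b z then s z else 1 - s z)"
      using odds[OF \<open>z \<in> S\<close>] by auto
  qed
  ultimately show ?thesis
    by (simp only: prod.distrib)
qed

section \<open>Counting the solutions of a linear system modulo m\<close>

definition modular_solutions :: "int \<Rightarrow> 'i set \<Rightarrow> ('k \<Rightarrow> 'i \<Rightarrow> int) \<Rightarrow> 'k set \<Rightarrow> ('i \<Rightarrow> int) set" where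
  "modular_solutions m I A W =
     {g \<in> I \<rightarrow>\<^sub>E {0..<m}. \<forall>k\<in>W. m dvd (\<Sum>i\<in>I. A k i * g i)}"

text \<open>
  Subtraction in the finite abelian group of functions from \<open>I\<close> to the integers modulo \<open>m\<close>, with
  representatives in \<open>{0..<m}\<close>.
\<close>

definition mod_diff :: "int \<Rightarrow> 'i set \<Rightarrow> ('i \<Rightarrow> int) \<Rightarrow> ('i \<Rightarrow> int) \<Rightarrow> 'i \<Rightarrow> int" where
  "mod_diff m I g h = (\<lambda>i\<in>I. (g i - h i) mod m)"

lemma finite_modular_solutions: "finite I \<Longrightarrow> finite (modular_solutions m I A W)"
  unfolding modular_solutions_def
  by (rule finite_subset[of _ "I \<rightarrow>\<^sub>E {0..<m}"]) (auto intro: finite_PiE)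

lemma modular_solutions_anti_mono:
  "V \<subseteq> W \<Longrightarrow> modular_solutions m I A W \<subseteq> modular_solutions m I A V"
  by (auto simp: modular_solutions_def)

lemma zero_modular_solution:
  "0 < m \<Longrightarrow> (\<lambda>i\<in>I. 0) \<in> modular_solutions m I A W"
  by (auto simp: modular_solutions_def)

lemma dvd_sum_mod_iff:
  fixes m :: int
  shows "m dvd (\<Sum>i\<in>I. a i * (x i mod m)) \<longleftrightarrow> m dvd (\<Sum>i\<in>I. a i * x i)"
proof -
  have "(\<Sum>i\<in>I. a i * (x i mod m)) mod m = (\<Sum>i\<in>I. a i * (x i mod m) mod m) mod m"
    by (simp add: mod_sum_eq)
  also have "\<dots> = (\<Sum>i\<in>I. a i * x i) mod m"
    by (simp add: mod_mult_right_eq mod_sum_eq)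
  finally show ?thesis by (simp add: dvd_eq_mod_eq_0)
qed

lemma mod_diff_in_solutions_iff:
  assumes "0 < m"
  shows "mod_diff m I g h \<in> modular_solutions m I A W \<longleftrightarrow>
    (\<forall>k\<in>W. m dvd (\<Sum>i\<in>I. A k i * g i) - (\<Sum>i\<in>I. A k i * h i))"
proof -
  have "m dvd (\<Sum>i\<in>I. A k i * mod_diff m I g h i) \<longleftrightarrow>
      m dvd (\<Sum>i\<in>I. A k i * g i) - (\<Sum>i\<in>I. A k i * h i)" for k
    by (simp add: mod_diff_def dvd_sum_mod_iff right_diff_distrib sum_subtractf)
  then show ?thesis
    using assms by (auto simp: modular_solutions_def mod_diff_def)
qed

lemma mod_diff_cancel:
  assumes "g \<in> I \<rightarrow>\<^sub>E {0..<m}" "g' \<in> I \<rightarrow>\<^sub>E {0..<m}" "mod_diff m I g h = mod_diff m I g' h"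
  shows "g = g'"
proof (rule PiE_ext[OF assms(1,2)])
  fix i assume i: "i \<in> I"
  then have "(g i - h i) mod m = (g' i - h i) mod m"
    using fun_cong[OF assms(3), of i] by (simp add: mod_diff_def)
  then have "g i mod m = g' i mod m"
    by (simp add: mod_eq_dvd_iff)
  moreover have "g i \<in> {0..<m}" "g' i \<in> {0..<m}"
    using assms(1,2) i by auto
  ultimately show "g i = g' i" by simp
qed

text \<open>
  The counting half of the homomorphism theorem: \<open>d x y\<close> plays the role of \<open>x - y\<close>, and
  subtracting a fixed representative embeds every fibre of \<open>F\<close> into the kernel \<open>K\<close>.
\<close>

lemma card_le_image_times_fibre:
  assumes "finite B" "finite K" "F ` A \<subseteq> B"
    and diff: "\<And>x y. x \<in> A \<Longrightarrow> y \<in> A \<Longrightarrow> F x = F y \<Longrightarrow> d x y \<in> K"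
    and cancel: "\<And>x x' y. x \<in> A \<Longrightarrow> x' \<in> A \<Longrightarrow> y \<in> A \<Longrightarrow> F x = F y \<Longrightarrow> F x' = F y \<Longrightarrow>
      d x y = d x' y \<Longrightarrow> x = x'"
  shows "card A \<le> card B * card K"
proof -
  define rep where "rep x = (SOME y. y \<in> A \<and> F y = F x)" for x
  have rep: "rep x \<in> A" "F (rep x) = F x" if "x \<in> A" for x
    using someI[of "\<lambda>y. y \<in> A \<and> F y = F x" x] that unfolding rep_def by blast+
  have "inj_on (\<lambda>x. (F x, d x (rep x))) A"
  proof (rule inj_onI)
    fix x x' assume x: "x \<in> A" "x' \<in> A" and eq: "(F x, d x (rep x)) = (F x', d x' (rep x'))"
    have "rep x = rep x'" unfolding rep_def using eq by simp
    show "x = x'"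
    proof (rule cancel[OF x rep(1)[OF x(1)]])
      show "F x = F (rep x)" using rep(2)[OF x(1)] by (rule sym)
      show "F x' = F (rep x)" using rep(2)[OF x(1)] eq by simp
      show "d x (rep x) = d x' (rep x)" using eq \<open>rep x = rep x'\<close> by simp
    qed
  qed
  moreover have "(\<lambda>x. (F x, d x (rep x))) ` A \<subseteq> B \<times> K"
  proof safe
    fix x assume x: "x \<in> A"
    show "F x \<in> B" using x assms(3) by blast
    show "d x (rep x) \<in> K" by (rule diff[OF x rep(1)[OF x]]) (rule rep(2)[OF x, symmetric])
  qed
  ultimately have "card A \<le> card (B \<times> K)"
    using assms(1,2) by (intro card_inj_on_le) auto
  then show ?thesis by (simp add: card_cartesian_product)
qed

text \<open>
  The solution sets \<open>H\<close> of \<open>V\<close> and \<open>K\<close> of \<open>W\<close> are subgroups, both contained in the solution set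
  of \<open>V \<inter> W\<close>. The difference map from \<open>H \<times> K\<close> takes values there, and its fibres embed into
  \<open>H \<inter> K\<close>, the solution set of \<open>V \<union> W\<close>, through the first component.
\<close>

lemma card_modular_solutions_supermodular:
  assumes "finite I" "0 < m"
  shows "card (modular_solutions m I A V) * card (modular_solutions m I A W) \<le>
    card (modular_solutions m I A (V \<inter> W)) * card (modular_solutions m I A (V \<union> W))"
proof -
  let ?L = "modular_solutions m I A"
  have "card (?L V \<times> ?L W) \<le> card (?L (V \<inter> W)) * card (?L (V \<union> W))"
  proof (rule card_le_image_times_fibre)
    show "(\<lambda>(g, h). mod_diff m I g h) ` (?L V \<times> ?L W) \<subseteq> ?L (V \<inter> W)"
      using assms by (auto simp: mod_diff_in_solutions_iff) (auto simp: modular_solutions_def)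
    show "mod_diff m I (fst x) (fst y) \<in> ?L (V \<union> W)"
      if "x \<in> ?L V \<times> ?L W" "y \<in> ?L V \<times> ?L W"
        and eq: "(case x of (g, h) \<Rightarrow> mod_diff m I g h) = (case y of (g, h) \<Rightarrow> mod_diff m I g h)"
      for x y
    proof -
      obtain g h g' h' where xy: "x = (g, h)" "y = (g', h')" by (cases x, cases y)
      have "m dvd (\<Sum>i\<in>I. A k i * g i) - (\<Sum>i\<in>I. A k i * g' i)" if k: "k \<in> V \<union> W" for k
      proof (cases "k \<in> V")
        case True
        then show ?thesis using that xy \<open>x \<in> _\<close> \<open>y \<in> _\<close> by (auto simp: modular_solutions_def)
      next
        case False
        \<comment> \<open>\<open>g - h = g' - h'\<close> means \<open>g - g' = h - h'\<close>, and the right side solves \<open>W\<close>.\<close>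
        have "mod_diff m I g g' = mod_diff m I h h'"
        proof
          fix i
          have "(g i - h i) mod m = (g' i - h' i) mod m" if "i \<in> I"
            using fun_cong[OF eq, of i] that by (simp add: xy mod_diff_def)
          then have "m dvd (g i - g' i) - (h i - h' i)" if "i \<in> I"
            using that by (simp add: mod_eq_dvd_iff algebra_simps)
          then show "mod_diff m I g g' i = mod_diff m I h h' i"
            by (simp add: mod_diff_def mod_eq_dvd_iff)
        qed
        moreover have "mod_diff m I h h' \<in> ?L W"
          using that xy \<open>x \<in> _\<close> \<open>y \<in> _\<close> assms
          by (auto simp: mod_diff_in_solutions_iff) (auto simp: modular_solutions_def)
        ultimately have "mod_diff m I g g' \<in> ?L W" by simp
        then show ?thesis
          using False k assms by (auto simp: mod_diff_in_solutions_iff)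
      qed
      then show ?thesis using assms by (simp add: mod_diff_in_solutions_iff xy)
    qed
    show "x = x'"
      if "x \<in> ?L V \<times> ?L W" "x' \<in> ?L V \<times> ?L W" "y \<in> ?L V \<times> ?L W"
        and F: "(case x of (g, h) \<Rightarrow> mod_diff m I g h) = (case y of (g, h) \<Rightarrow> mod_diff m I g h)"
          "(case x' of (g, h) \<Rightarrow> mod_diff m I g h) = (case y of (g, h) \<Rightarrow> mod_diff m I g h)"
        and d: "mod_diff m I (fst x) (fst y) = mod_diff m I (fst x') (fst y)"
      for x x' y
    proof -
      obtain g h g' h' where xy: "x = (g, h)" "x' = (g', h')" by (cases x, cases x')
      have mem: "g \<in> I \<rightarrow>\<^sub>E {0..<m}" "g' \<in> I \<rightarrow>\<^sub>E {0..<m}" "h \<in> I \<rightarrow>\<^sub>E {0..<m}" "h' \<in> I \<rightarrow>\<^sub>E {0..<m}"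
        using that(1,2) by (auto simp: xy modular_solutions_def)
      have "g = g'"
        using mod_diff_cancel[OF mem(1,2)] d by (simp add: xy)
      moreover have "mod_diff m I h g = mod_diff m I h' g"
      proof
        fix i
        have "(g i - h i) mod m = (g i - h' i) mod m" if "i \<in> I"
        proof -
          have "mod_diff m I g h = mod_diff m I g h'"
            using F \<open>g = g'\<close> by (simp add: xy)
          from fun_cong[OF this, of i] show ?thesis
            using \<open>i \<in> I\<close> by (simp add: mod_diff_def)
        qed
        then have "m dvd (h i - g i) - (h' i - g i)" if "i \<in> I"
          using that by (simp add: mod_eq_dvd_iff dvd_diff_commute)
        then show "mod_diff m I h g i = mod_diff m I h' g i"
          by (simp add: mod_diff_def mod_eq_dvd_iff)
      qed
      then have "h = h'" by (rule mod_diff_cancel[OF mem(3,4)])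
      ultimately show ?thesis by (simp add: xy)
    qed
  qed (use assms in \<open>auto intro: finite_modular_solutions\<close>)
  then show ?thesis by (simp add: card_cartesian_product)
qed

text \<open>
  Evaluating the equation \<open>k\<close> takes at most \<open>m\<close> values modulo \<open>m\<close>, and its fibres are cosets of
  the solutions of the enlarged system.
\<close>

lemma card_modular_solutions_insert:
  assumes "finite I" "0 < m"
  shows "card (modular_solutions m I A W) \<le> nat m * card (modular_solutions m I A (insert k W))"
proof -
  let ?F = "\<lambda>g. (\<Sum>i\<in>I. A k i * g i) mod m"
  have "card (modular_solutions m I A W) \<le> card {0..<m} * card (modular_solutions m I A (insert k W))"
  proof (rule card_le_image_times_fibre[where F = ?F and d = "mod_diff m I"])
    show "?F ` modular_solutions m I A W \<subseteq> {0..<m}"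
      using assms by auto
    show "mod_diff m I g h \<in> modular_solutions m I A (insert k W)"
      if "g \<in> modular_solutions m I A W" "h \<in> modular_solutions m I A W" "?F g = ?F h" for g h
    proof -
      have "m dvd (\<Sum>i\<in>I. A k i * g i) - (\<Sum>i\<in>I. A k i * h i)"
        using that(3) by (simp add: mod_eq_dvd_iff)
      then show ?thesis
        using that(1,2) assms by (auto simp: mod_diff_in_solutions_iff) (auto simp: modular_solutions_def)
    qed
    show "g = g'"
      if "g \<in> modular_solutions m I A W" "g' \<in> modular_solutions m I A W"
        "mod_diff m I g h = mod_diff m I g' h" for g g' h
      using that mod_diff_cancel[of g I m g' h] by (auto simp: modular_solutions_def)
  qed (use assms in \<open>auto intro: finite_modular_solutions\<close>)
  then show ?thesis by simp
qed

lemma card_modular_solutions_union: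
  assumes "finite I" "0 < m" "finite V"
  shows "card (modular_solutions m I A W) \<le>
    nat m ^ card (V - W) * card (modular_solutions m I A (V \<union> W))"
proof -
  have "card (modular_solutions m I A W) \<le>
      nat m ^ card U * card (modular_solutions m I A (U \<union> W))" if "finite U" for U
    using that
  proof (induction U)
    case (insert k U)
    note insert.IH
    also have "nat m ^ card U * card (modular_solutions m I A (U \<union> W)) \<le>
        nat m ^ card U * (nat m * card (modular_solutions m I A (insert k (U \<union> W))))"
      by (intro mult_le_mono2 card_modular_solutions_insert assms)
    finally show ?case using insert.hyps by (simp add: mult.assoc mult.left_commute[of "nat m"])
  qed (rule eq_refl, simp)
  from this[of "V - W"] show ?thesis using assms by simp
qed

section \<open>Relative cohomology as the solution set of a linear system\<close>

context residues
begin

lemma add_pow_int_eq: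
  assumes x: "x \<in> carrier R"
  shows "[(k::int)] \<cdot> x = (k * x) mod m"
proof -
  have nat: "[(n::nat)] \<cdot> x = (int n * x) mod m" for n
    by (induction n)
      (simp_all add: add_pow_def nat_pow_def res_zero_eq res_add_eq mod_add_right_eq algebra_simps)
  show ?thesis
  proof (cases "k < 0")
    case True
    then show ?thesis
      by (simp add: add_pow_int_lt nat res_neg_eq mod_minus_eq)
  next
    case False
    then show ?thesis
      by (simp add: add_pow_int_ge nat)
  qed
qed

lemma finsum_eq_sum_mod:
  assumes "finite I" "f \<in> I \<rightarrow> carrier R"
  shows "(\<Oplus>i\<in>I. f i) = (\<Sum>i\<in>I. f i) mod m"
  using assms
proof (induction I)
  case empty
  show ?case by (simp add: res_zero_eq)
next
  case (insert i I)
  then show ?case by (simp add: res_add_eq mod_add_right_eq)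
qed

end

lemma mem_cochain_group_iff:
  assumes "1 < q"
  shows "f \<in> carrier (cochain_group X q A B j) \<longleftrightarrow>
    f \<in> oriented_cells X A j \<rightarrow>\<^sub>E {0..<int q} \<and>
    (\<forall>c\<in>cells_of X A j. \<forall>e. f (c, \<not> e) = (- f (c, e)) mod int q) \<and>
    (\<forall>x\<in>oriented_cells X B j. f x = 0)"
proof -
  interpret residues "int q" "Z_mod q"
    using assms by unfold_locales auto
  have "{0..int q - 1} = {0..<int q}" by auto
  then show ?thesis
    by (simp add: cochain_group_def res_zero_eq res_carrier_eq res_neg_eq oriented_cells_def)
qed

lemma restrict_eq_restrict_iff: "restrict f A = restrict g A \<longleftrightarrow> (\<forall>x\<in>A. f x = g x)"
proof
  assume eq: "restrict f A = restrict g A"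
  show "\<forall>x\<in>A. f x = g x"
    using fun_cong[OF eq] by (metis restrict_apply')
qed (auto intro: restrict_ext)

lemma coboundary_eq:
  assumes "1 < q" "finite (cells_of X A j)"
    and "\<And>c. c \<in> cells_of X A j \<Longrightarrow> f (c, True) \<in> {0..<int q}"
  shows "coboundary X q A j f = (\<lambda>(s, e)\<in>oriented_cells X A (Suc j).
    (orientation_sign e * (\<Sum>c\<in>cells_of X A j. incidence X s c * f (c, True))) mod int q)"
proof -
  interpret residues "int q" "Z_mod q"
    using assms(1) by unfold_locales auto
  have f: "f (c, True) \<in> carrier (Z_mod q)" if "c \<in> cells_of X A j" for c
    using assms(3)[OF that] by (simp add: res_carrier_eq)
  have "(\<Oplus>\<^bsub>Z_mod q\<^esub>c\<in>cells_of X A j. [(orientation_sign e * incidence X s c)] \<cdot>\<^bsub>Z_mod q\<^esub> f (c, True)) =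
      (orientation_sign e * (\<Sum>c\<in>cells_of X A j. incidence X s c * f (c, True))) mod int q" for s e
  proof -
    have "(\<Oplus>\<^bsub>Z_mod q\<^esub>c\<in>cells_of X A j. [(orientation_sign e * incidence X s c)] \<cdot>\<^bsub>Z_mod q\<^esub> f (c, True)) =
        (\<Sum>c\<in>cells_of X A j. [(orientation_sign e * incidence X s c)] \<cdot>\<^bsub>Z_mod q\<^esub> f (c, True)) mod int q"
      using f assms(2) by (intro finsum_eq_sum_mod) (auto simp: add_pow_int_eq)
    also have "\<dots> = (\<Sum>c\<in>cells_of X A j. (orientation_sign e * incidence X s c * f (c, True)) mod int q) mod int q"
      using f by (simp add: add_pow_int_eq)
    also have "\<dots> = (orientation_sign e * (\<Sum>c\<in>cells_of X A j. incidence X s c * f (c, True))) mod int q"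
      by (simp add: mod_sum_eq sum_distrib_left mult.assoc)
    finally show ?thesis .
  qed
  then show ?thesis
    unfolding coboundary_def by simp
qed

text \<open>
  The two subcomplexes differ only in dimensions \<open>i\<close> and \<open>i + 1\<close>. Part 2 is what makes all
  relative cochains of degree below \<open>i\<close> vanish.
\<close>

lemma percolation_pair_cells:
  assumes "(P2, P1) \<in> percolation_pairs X i"
  shows "cells_of X P2 i = cells_of X (cells X) i"
    and "k < i \<Longrightarrow> cells_of X P1 k = cells_of X P2 k"
    and "cells_of X P1 i \<subseteq> cells_of X (cells X) i"
    and "cells_of X P2 (Suc i) \<subseteq> cells_of X (cells X) (Suc i)"
proof -
  have "P2 \<subseteq> cells X" "skeleton X (int i) \<subseteq> P2" "P1 \<subseteq> cells X" "skeleton X (int i - 1) \<subseteq> P1"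
    using assms by (simp_all add: percolation_pairs_def percolation_subcomplex_def subcomplex_def)
  moreover have "c \<in> skeleton X (int i)" if "c \<in> cells X" "cell_dim X c \<le> i" for c
    using that by (simp add: skeleton_def)
  moreover have "c \<in> skeleton X (int i - 1)" if "c \<in> cells X" "cell_dim X c < i" for c
    using that by (simp add: skeleton_def)
  ultimately have P2: "P2 \<subseteq> cells X" "\<And>c. c \<in> cells X \<Longrightarrow> cell_dim X c \<le> i \<Longrightarrow> c \<in> P2"
    and P1: "P1 \<subseteq> cells X" "\<And>c. c \<in> cells X \<Longrightarrow> cell_dim X c < i \<Longrightarrow> c \<in> P1"
    by blast+
  show "cells_of X P2 i = cells_of X (cells X) i"
    using P2(1) P2(2) unfolding cells_of_def by blast
  show "cells_of X P1 k = cells_of X P2 k" if "k < i"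
    using P1 P2 that unfolding cells_of_def by (intro Collect_cong) (metis less_imp_le subsetD)
  show "cells_of X P1 i \<subseteq> cells_of X (cells X) i"
    and "cells_of X P2 (Suc i) \<subseteq> cells_of X (cells X) (Suc i)"
    using P1(1) P2(1) unfolding cells_of_def by blast+
qed

text \<open>
  A coboundary comes from a cochain of degree \<open>i - 1\<close> that vanishes on the cells of \<open>P1\<close>. These
  include all cells of dimension \<open>i - 1\<close>, so the cochain is zero.
\<close>

lemma coboundaries_percolation_pair:
  assumes "1 < q" "finite (cells X)" and P: "(P2, P1) \<in> percolation_pairs X i"
  shows "coboundaries X q P2 P1 i = {\<one>\<^bsub>cochain_group X q P2 P1 i\<^esub>}"
proof (cases i)
  case 0
  then show ?thesis by (simp add: coboundaries_def)
next
  case (Suc k)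
  interpret residues "int q" "Z_mod q"
    using assms(1) by unfold_locales auto
  have cells: "cells_of X P1 k = cells_of X P2 k"
    using percolation_pair_cells(2)[OF P] Suc by simp
  define zero where "zero = (\<lambda>x\<in>oriented_cells X P2 k. 0 :: int)"
  have "carrier (cochain_group X q P2 P1 k) = {zero}"
  proof (intro equalityI subsetI)
    fix f assume "f \<in> carrier (cochain_group X q P2 P1 k)"
    then have f: "f \<in> oriented_cells X P2 k \<rightarrow>\<^sub>E {0..<int q}" "\<forall>x\<in>oriented_cells X P2 k. f x = 0"
      unfolding mem_cochain_group_iff[OF assms(1)] oriented_cells_def cells
      by - (elim conjE, assumption)+
    have "f x = zero x" for x
      using f(2) PiE_arb[OF f(1)] by (cases "x \<in> oriented_cells X P2 k") (simp_all add: zero_def)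
    then show "f \<in> {zero}" by auto
  next
    have "zero \<in> carrier (cochain_group X q P2 P1 k)"
      unfolding mem_cochain_group_iff[OF assms(1)]
      using assms(1) by (auto simp: zero_def oriented_cells_def cells)
    then show "f \<in> {zero} \<Longrightarrow> f \<in> carrier (cochain_group X q P2 P1 k)" for f
      by simp
  qed
  moreover have "coboundary X q P2 k zero = \<one>\<^bsub>cochain_group X q P2 P1 (Suc k)\<^esub>"
  proof -
    have "cells_of X P2 k \<subseteq> cells X"
      using P by (auto simp: percolation_pairs_def percolation_subcomplex_def subcomplex_def cells_of_def)
    then have "finite (cells_of X P2 k)"
      using assms(2) by (rule finite_subset)
    then have "coboundary X q P2 k zero = (\<lambda>(s, e)\<in>oriented_cells X P2 (Suc k).
        (orientation_sign e * (\<Sum>c\<in>cells_of X P2 k. incidence X s c * zero (c, True))) mod int q)"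
      using assms(1) by (intro coboundary_eq) (auto simp: zero_def oriented_cells_def)
    also have "\<dots> = (\<lambda>x\<in>oriented_cells X P2 (Suc k). 0)"
      by (auto simp: zero_def oriented_cells_def fun_eq_iff)
    finally show ?thesis by (simp add: cochain_group_def res_zero_eq)
  qed
  ultimately show ?thesis using Suc by (simp add: coboundaries_def)
qed

text \<open>
  The quotient is by the trivial group, so its elements are the singletons of cocycles.
\<close>

lemma order_relative_cohomology:
  assumes "1 < q" "finite (cells X)" and P: "(P2, P1) \<in> percolation_pairs X i"
  shows "order (relative_cohomology X q P2 P1 i) = card (cocycles X q P2 P1 i)"
proof -
  interpret residues "int q" "Z_mod q"
    using assms(1) by unfold_locales auto
  let ?G = "cochain_group X q P2 P1 i"
  have unit: "mult ?G (one ?G) f = f" if "f \<in> cocycles X q P2 P1 i" for f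
  proof
    fix x
    have f: "f \<in> oriented_cells X P2 i \<rightarrow>\<^sub>E {0..<int q}"
      using that unfolding cocycles_def mem_cochain_group_iff[OF assms(1)] mem_Collect_eq
      by (elim conjE)
    show "mult ?G (one ?G) f x = f x"
    proof (cases "x \<in> oriented_cells X P2 i")
      case True
      then have "0 \<le> f x" "f x < int q"
        using PiE_mem[OF f True] by auto
      then show ?thesis using True by (simp add: cochain_group_def res_zero_eq res_add_eq)
    next
      case False
      then show ?thesis using PiE_arb[OF f False] by (simp add: cochain_group_def)
    qed
  qed
  have "carrier (relative_cohomology X q P2 P1 i) = (\<lambda>f. {f}) ` cocycles X q P2 P1 i"
  proof -
    have "carrier (relative_cohomology X q P2 P1 i) =
        (\<Union>f\<in>cocycles X q P2 P1 i. {{mult ?G (one ?G) f}})"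
      unfolding relative_cohomology_def FactGroup_def RCOSETS_def r_coset_def
        coboundaries_percolation_pair[OF assms] by simp
    also have "\<dots> = (\<Union>f\<in>cocycles X q P2 P1 i. {{f}})"
      using unit by (intro SUP_cong refl) simp
    finally show ?thesis by blast
  qed
  then show ?thesis
    by (simp add: order_def card_image)
qed

text \<open>
  The row of the linear system that belongs to the open cell \<open>z\<close>: the coboundary at \<open>z\<close> for
  an \<open>(i + 1)\<close>-cell, and the value at \<open>z\<close> for an \<open>i\<close>-cell.
\<close>

definition cochain_constraint :: "('a, 'c) cell_complex \<Rightarrow> nat \<Rightarrow> 'c \<Rightarrow> 'c \<Rightarrow> int" where
  "cochain_constraint X i z c =
     (if cell_dim X z = Suc i then incidence X z c else if c = z then 1 else 0)"

lemma mem_cocycles_iff: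
  assumes "1 < q" "finite (cells X)" and P: "(P2, P1) \<in> percolation_pairs X i"
  shows "f \<in> cocycles X q P2 P1 i \<longleftrightarrow>
    f \<in> cells_of X (cells X) i \<times> UNIV \<rightarrow>\<^sub>E {0..<int q} \<and>
    (\<forall>c\<in>cells_of X (cells X) i. \<forall>e. f (c, \<not> e) = (- f (c, e)) mod int q) \<and>
    (\<forall>c\<in>cells_of X P1 i. \<forall>e. f (c, e) = 0) \<and>
    (\<forall>s\<in>cells_of X P2 (Suc i).
       int q dvd (\<Sum>c\<in>cells_of X (cells X) i. incidence X s c * f (c, True)))"
proof -
  interpret residues "int q" "Z_mod q"
    using assms(1) by unfold_locales auto
  note cells = percolation_pair_cells(1)[OF P]
  let ?I = "cells_of X (cells X) i"
  have closed: "coboundary X q P2 i f = \<one>\<^bsub>cochain_group X q P2 P1 (Suc i)\<^esub> \<longleftrightarrow>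
    (\<forall>s\<in>cells_of X P2 (Suc i). int q dvd (\<Sum>c\<in>?I. incidence X s c * f (c, True)))"
    if "f \<in> ?I \<times> UNIV \<rightarrow>\<^sub>E {0..<int q}"
  proof -
    have "finite ?I" using assms(2) by (simp add: cells_of_def)
    moreover have "f (c, True) \<in> {0..<int q}" if "c \<in> ?I" for c
      using PiE_mem[OF \<open>f \<in> _\<close>, of "(c, True)"] that by simp
    ultimately have "coboundary X q P2 i f = (\<lambda>(s, e)\<in>oriented_cells X P2 (Suc i).
        (orientation_sign e * (\<Sum>c\<in>?I. incidence X s c * f (c, True))) mod int q)"
      using coboundary_eq[of q X P2 i f] assms(1) by (simp only: cells)
    moreover have "(orientation_sign e * n) mod int q = 0 \<longleftrightarrow> int q dvd n" for e n
      by (simp add: orientation_sign_def flip: dvd_eq_mod_eq_0)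
    ultimately show ?thesis
      by (simp add: cochain_group_def res_zero_eq oriented_cells_def restrict_eq_restrict_iff)
  qed
  have "f \<in> carrier (cochain_group X q P2 P1 i) \<longleftrightarrow>
    f \<in> ?I \<times> UNIV \<rightarrow>\<^sub>E {0..<int q} \<and>
    (\<forall>c\<in>?I. \<forall>e. f (c, \<not> e) = (- f (c, e)) mod int q) \<and>
    (\<forall>c\<in>cells_of X P1 i. \<forall>e. f (c, e) = 0)"
    unfolding mem_cochain_group_iff[OF assms(1)] by (simp add: oriented_cells_def cells)
  with closed show ?thesis
    unfolding cocycles_def mem_Collect_eq by (simp only: conj_assoc cong: conj_cong)
qed

text \<open>
  A cochain is determined by its values on the cells with the orientation of their characteristic
  maps; restricting to these values is the bijection.
\<close>

lemma card_cocycles: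
  fixes X :: "('a, 'c) cell_complex"
  assumes "1 < q" "finite (cells X)" and P: "(P2, P1) \<in> percolation_pairs X i"
  shows "card (cocycles X q P2 P1 i) = card (modular_solutions (int q) (cells_of X (cells X) i)
    (cochain_constraint X i) (cells_of X P2 (Suc i) \<union> cells_of X P1 i))"
proof -
  let ?I = "cells_of X (cells X) i" and ?W = "cells_of X P2 (Suc i) \<union> cells_of X P1 i"
  let ?L = "modular_solutions (int q) ?I (cochain_constraint X i) ?W"
  have "finite ?I" using assms(2) by (simp add: cells_of_def)
  define F where "F f = (\<lambda>c\<in>?I. f (c, True))" for f :: "'c \<times> bool \<Rightarrow> int"
  define F' where "F' g = (\<lambda>(c, e)\<in>?I \<times> UNIV. if e then g c else (- g c) mod int q)"
    for g :: "'c \<Rightarrow> int"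
  have mem_L: "g \<in> ?L \<longleftrightarrow> g \<in> ?I \<rightarrow>\<^sub>E {0..<int q} \<and> (\<forall>c\<in>cells_of X P1 i. g c = 0) \<and>
      (\<forall>s\<in>cells_of X P2 (Suc i). int q dvd (\<Sum>c\<in>?I. incidence X s c * g c))" for g
  proof -
    have "(\<Sum>c\<in>?I. cochain_constraint X i s c * g c) = (\<Sum>c\<in>?I. incidence X s c * g c)"
      if "s \<in> cells_of X P2 (Suc i)" for s
      using that by (simp add: cochain_constraint_def cells_of_def)
    moreover have "int q dvd (\<Sum>c\<in>?I. cochain_constraint X i z c * g c) \<longleftrightarrow> g z = 0"
      if z: "z \<in> cells_of X P1 i" and g: "g \<in> ?I \<rightarrow>\<^sub>E {0..<int q}" for z
    proof -
      have "z \<in> ?I" using percolation_pair_cells(3)[OF P] z by blast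
      have "cell_dim X z \<noteq> Suc i" using z by (simp add: cells_of_def)
      then have "(\<Sum>c\<in>?I. cochain_constraint X i z c * g c) = (\<Sum>c\<in>?I. if c = z then g c else 0)"
        by (intro sum.cong) (auto simp: cochain_constraint_def)
      also have "\<dots> = g z"
        using \<open>finite ?I\<close> \<open>z \<in> ?I\<close> by simp
      finally have eq: "(\<Sum>c\<in>?I. cochain_constraint X i z c * g c) = g z" .
      have "0 \<le> g z" "g z < int q"
        using PiE_mem[OF g \<open>z \<in> ?I\<close>] by auto
      then show ?thesis
        unfolding eq using zdvd_not_zless[of "g z" "int q"] by (cases "g z = 0") simp_all
    qed
    ultimately show ?thesis
      unfolding modular_solutions_def by (simp add: ball_Un) blast
  qed
  have "bij_betw F (cocycles X q P2 P1 i) ?L"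
  proof (rule bij_betw_byWitness[where f' = F'])
    show "\<forall>f\<in>cocycles X q P2 P1 i. F' (F f) = f"
    proof
      fix f assume "f \<in> cocycles X q P2 P1 i"
      then have f: "f \<in> ?I \<times> UNIV \<rightarrow>\<^sub>E {0..<int q}"
        "\<forall>c\<in>?I. \<forall>e. f (c, \<not> e) = (- f (c, e)) mod int q"
        unfolding mem_cocycles_iff[OF assms] by - (elim conjE, assumption)+
      show "F' (F f) = f"
      proof
        fix x :: "'c \<times> bool"
        obtain c e where x: "x = (c, e)" by (cases x)
        show "F' (F f) x = f x"
        proof (cases "c \<in> ?I")
          case True
          then have "f (c, False) = (- f (c, True)) mod int q"
            using f(2) by (metis (full_types))
          then show ?thesis using True by (simp add: x F_def F'_def)
        next
          case False
          then show ?thesis using PiE_arb[OF f(1), of x] by (simp add: x F'_def)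
        qed
      qed
    qed
    show "\<forall>g\<in>?L. F (F' g) = g"
    proof
      fix g assume "g \<in> ?L"
      then have "g \<in> extensional ?I" by (simp add: mem_L PiE_def)
      then show "F (F' g) = g"
        by (auto simp: F_def F'_def fun_eq_iff extensional_def)
    qed
    show "F ` cocycles X q P2 P1 i \<subseteq> ?L"
    proof safe
      fix f assume "f \<in> cocycles X q P2 P1 i"
      then have f: "f \<in> ?I \<times> UNIV \<rightarrow>\<^sub>E {0..<int q}" "\<forall>c\<in>cells_of X P1 i. \<forall>e. f (c, e) = 0"
        "\<forall>s\<in>cells_of X P2 (Suc i). int q dvd (\<Sum>c\<in>?I. incidence X s c * f (c, True))"
        unfolding mem_cocycles_iff[OF assms] by - (elim conjE, assumption)+
      have "F f \<in> ?I \<rightarrow>\<^sub>E {0..<int q}"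
        using PiE_mem[OF f(1)] by (auto simp: F_def)
      moreover have "F f c = 0" if "c \<in> cells_of X P1 i" for c
        using that f(2) percolation_pair_cells(3)[OF P] by (auto simp: F_def)
      moreover have "int q dvd (\<Sum>c\<in>?I. incidence X s c * F f c)" if "s \<in> cells_of X P2 (Suc i)" for s
        using f(3) that by (simp add: F_def)
      ultimately show "F f \<in> ?L" by (simp add: mem_L)
    qed
    show "F' ` ?L \<subseteq> cocycles X q P2 P1 i"
    proof safe
      fix g assume "g \<in> ?L"
      then have g: "g \<in> ?I \<rightarrow>\<^sub>E {0..<int q}" "\<forall>c\<in>cells_of X P1 i. g c = 0"
        "\<forall>s\<in>cells_of X P2 (Suc i). int q dvd (\<Sum>c\<in>?I. incidence X s c * g c)"
        by (auto simp: mem_L)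
      have range: "0 \<le> g c" "g c < int q" if "c \<in> ?I" for c
        using PiE_mem[OF g(1) that] by auto
      show "F' g \<in> cocycles X q P2 P1 i"
        unfolding mem_cocycles_iff[OF assms]
      proof (intro conjI ballI allI)
        show "F' g \<in> ?I \<times> UNIV \<rightarrow>\<^sub>E {0..<int q}"
          using range assms(1) by (auto simp: F'_def)
        show "F' g (c, \<not> e) = (- F' g (c, e)) mod int q" if "c \<in> ?I" for c e
          using that range[OF that] by (cases e) (simp_all add: F'_def mod_minus_eq)
        show "F' g (c, e) = 0" if "c \<in> cells_of X P1 i" for c e
          using that g(2) percolation_pair_cells(3)[OF P] by (auto simp: F'_def)
        show "int q dvd (\<Sum>c\<in>?I. incidence X s c * F' g (c, True))"
          if "s \<in> cells_of X P2 (Suc i)" for s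
          using g(3) that by (simp add: F'_def)
      qed
    qed
  qed
  then show ?thesis by (rule bij_betw_same_card)
qed

section \<open>The law of the coupled percolation\<close>

text \<open>
  The common form of the three comparisons: two Bernoulli product measures are reweighted by
  \<open>m1\<close> and \<open>m2\<close>, and a factor \<open>c\<close> for every site of \<open>a - b\<close> moves from the hypothesis on the
  probabilities to the one on the weights.
\<close>

lemma stochastically_dominates_reweighted:
  fixes S :: "'c set" and r s :: "'c \<Rightarrow> real" and c Z1 Z2 :: real
    and m1 m2 :: "('c \<Rightarrow> bool) \<Rightarrow> real"
  assumes S: "finite S" and "0 \<le> c" "0 < Z1" "0 < Z2"
    and r: "\<And>z. z \<in> S \<Longrightarrow> r z \<in> {0..1}" and s: "\<And>z. z \<in> S \<Longrightarrow> s z \<in> {0..1}"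
    and odds: "\<And>z. z \<in> S \<Longrightarrow> c * (r z * (1 - s z)) \<le> (1 - r z) * s z"
    and M1: "\<And>w. pmf M1 w = pmf (Pi_pmf S False (\<lambda>z. bernoulli_pmf (r z))) w * m1 w / Z1"
    and M2: "\<And>w. pmf M2 w = pmf (Pi_pmf S False (\<lambda>z. bernoulli_pmf (s z))) w * m2 w / Z2"
    and nonneg: "\<And>w. 0 \<le> m1 w" "\<And>w. 0 \<le> m2 w"
    and m: "\<And>a b. {z. a z} \<subseteq> S \<Longrightarrow> m1 a * m2 b \<le>
      c ^ card {z \<in> S. a z \<and> \<not> b z} * (m1 (inf a b) * m2 (sup a b))"
  shows "stochastically_dominates M2 M1"
  unfolding stochastically_dominates_iff_rel_pmf
proof (rule Holley[OF S])
  define B where "B = Pi_pmf S False (\<lambda>z. bernoulli_pmf (r z))"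
  define B' where "B' = Pi_pmf S False (\<lambda>z. bernoulli_pmf (s z))"
  have outside: "pmf B w = 0" "pmf B' w = 0" if "\<not> {z. w z} \<subseteq> S" for w
    using that S by (auto simp: B_def B'_def pmf_Pi)
  show "{z. w z} \<subseteq> S" if "w \<in> set_pmf M1 \<union> set_pmf M2" for w
  proof (rule ccontr)
    assume "\<not> {z. w z} \<subseteq> S"
    then show False
      using that outside[of w] M1[of w] M2[of w] by (auto simp: set_pmf_iff B_def B'_def)
  qed
  show "pmf M1 a * pmf M2 b \<le> pmf M1 (inf a b) * pmf M2 (sup a b)" for a b
  proof (cases "{z. a z} \<subseteq> S")
    case False
    then have "pmf M1 a = 0"
      using outside(1) M1[of a] by (simp add: B_def)
    then show ?thesis by simp
  next
    case True
    let ?k = "c ^ card {z \<in> S. a z \<and> \<not> b z}" and ?m = "m1 (inf a b) * m2 (sup a b)"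
    have "(pmf B a * pmf B' b) * (m1 a * m2 b) \<le> (pmf B a * pmf B' b) * (?k * ?m)"
      by (intro mult_left_mono m True) simp
    also have "\<dots> = (?k * (pmf B a * pmf B' b)) * ?m"
      by simp
    also have "\<dots> \<le> (pmf B (inf a b) * pmf B' (sup a b)) * ?m"
      unfolding B_def B'_def
      by (intro mult_right_mono pmf_Pi_bernoulli_lattice mult_nonneg_nonneg nonneg)
        (use S \<open>0 \<le> c\<close> r s odds in auto)
    finally have "(pmf B a * pmf B' b) * (m1 a * m2 b) / (Z1 * Z2) \<le>
        (pmf B (inf a b) * pmf B' (sup a b)) * ?m / (Z1 * Z2)"
      using \<open>0 < Z1\<close> \<open>0 < Z2\<close> by (intro divide_right_mono) auto
    then show ?thesis
      unfolding M1 M2 B_def B'_def by (simp add: ac_simps)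
  qed
qed

text \<open>
  The boundary of a cell lies in cells of lower dimension, all of which are in the
  \<open>(j - 1)\<close>-skeleton. Hence any choice of \<open>j\<close>-cells is allowed, and percolation subcomplexes
  correspond to arbitrary binary assignments.
\<close>

lemma subcomplex_between_skeleta:
  assumes "finite_cell_complex X" "skeleton X (int j - 1) \<subseteq> P" "P \<subseteq> skeleton X (int j)"
  shows "subcomplex X P"
  unfolding subcomplex_def
proof (intro conjI ballI)
  show "P \<subseteq> cells X" using assms(3) by (auto simp: skeleton_def)
  fix c assume "c \<in> P"
  then have c: "c \<in> cells X" "cell_dim X c \<le> j"
    using assms(3) by (auto simp: skeleton_def)
  let ?D = "topspace (disc (cell_dim X c))" and ?U = "open_disc (cell_dim X c)"
  have "\<forall>c\<in>cells X. char_map X c ` (topspace (disc (cell_dim X c)) - open_disc (cell_dim X c))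
      \<subseteq> (\<Union>d\<in>{d \<in> cells X. cell_dim X d < cell_dim X c}. open_cell X d)"
    using assms(1) unfolding finite_cell_complex_def by (elim conjE)
  then have "char_map X c ` (?D - ?U) \<subseteq>
      (\<Union>d\<in>{d \<in> cells X. cell_dim X d < cell_dim X c}. open_cell X d)"
    using c(1) by (rule bspec)
  also have "\<dots> \<subseteq> (\<Union>d\<in>P. open_cell X d)"
    by (rule UN_mono) (use assms(2) c in \<open>auto simp: skeleton_def\<close>)
  finally have boundary: "char_map X c ` (?D - ?U) \<subseteq> (\<Union>d\<in>P. open_cell X d)" .
  have "closed_cell X c \<subseteq> open_cell X c \<union> char_map X c ` (?D - ?U)"
    unfolding closed_cell_def open_cell_def image_Un[symmetric] by (rule image_mono) auto
  also have "\<dots> \<subseteq> (\<Union>d\<in>P. open_cell X d)"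
    using UN_upper[OF \<open>c \<in> P\<close>] boundary by (rule Un_least)
  finally show "closed_cell X c \<subseteq> (\<Union>d\<in>P. open_cell X d)" .
qed

definition percolation_sites :: "('a, 'c) cell_complex \<Rightarrow> nat \<Rightarrow> 'c set" where
  "percolation_sites X i = cells_of X (cells X) (Suc i) \<union> cells_of X (cells X) i"

definition site_probability ::
  "('a, 'c) cell_complex \<Rightarrow> nat \<Rightarrow> real \<Rightarrow> real \<Rightarrow> 'c \<Rightarrow> real" where
  "site_probability X i p2 p1 z = (if cell_dim X z = Suc i then p2 else p1)"

lemma mem_skeleton_iff:
  "z \<in> skeleton X (int i) \<longleftrightarrow> z \<in> cells X \<and> cell_dim X z \<le> i"
  "z \<in> skeleton X (int i - 1) \<longleftrightarrow> z \<in> cells X \<and> cell_dim X z < i"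
  by (auto simp: skeleton_def)

lemma mem_percolation_pairs_iff:
  assumes "finite_cell_complex X"
  shows "(P2, P1) \<in> percolation_pairs X i \<longleftrightarrow>
    skeleton X (int i) \<subseteq> P2 \<and> P2 \<subseteq> skeleton X (int (Suc i)) \<and>
    skeleton X (int i - 1) \<subseteq> P1 \<and> P1 \<subseteq> skeleton X (int i)"
proof -
  have "int (Suc i) - 1 = int i" by simp
  then show ?thesis
    using subcomplex_between_skeleta[OF assms, of "Suc i" P2]
      subcomplex_between_skeleta[OF assms, of i P1]
    unfolding percolation_pairs_def percolation_subcomplex_def mem_Collect_eq case_prod_conv
    by (simp only:) blast
qed

lemma bij_betw_assignment_of:
  assumes "finite_cell_complex X"
  shows "bij_betw (assignment_of X i) (percolation_pairs X i) {w. {z. w z} \<subseteq> percolation_sites X i}"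
proof (rule bij_betw_byWitness[where f' = "\<lambda>w.
    (skeleton X (int i) \<union> {z \<in> cells_of X (cells X) (Suc i). w z},
     skeleton X (int i - 1) \<union> {z \<in> cells_of X (cells X) i. w z})"], goal_cases)
  case 1
  show ?case
  proof
    fix P assume "P \<in> percolation_pairs X i"
    moreover obtain P2 P1 where P12: "P = (P2, P1)" by (cases P)
    ultimately have P: "skeleton X (int i) \<subseteq> P2" "P2 \<subseteq> skeleton X (int (Suc i))"
      "skeleton X (int i - 1) \<subseteq> P1" "P1 \<subseteq> skeleton X (int i)"
      by (simp_all only: mem_percolation_pairs_iff[OF assms])
    have "z \<in> cells X" "\<not> cell_dim X z \<le> i \<Longrightarrow> cell_dim X z = Suc i" if "z \<in> P2" for z
      using subsetD[OF P(2) that] by (simp_all add: mem_skeleton_iff del: of_nat_Suc)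
    moreover have "z \<in> P2" if "z \<in> cells X" "cell_dim X z \<le> i" for z
      using subsetD[OF P(1)] that by (simp only: mem_skeleton_iff)
    ultimately have eq2: "skeleton X (int i) \<union>
        {z \<in> cells_of X (cells X) (Suc i). assignment_of X i (P2, P1) z} = P2"
      by (auto simp: assignment_of_def cells_of_def mem_skeleton_iff)
    have "z \<in> cells X" "\<not> cell_dim X z < i \<Longrightarrow> cell_dim X z = i" if "z \<in> P1" for z
      using subsetD[OF P(4) that] by (simp_all add: mem_skeleton_iff)
    moreover have "z \<in> P1" if "z \<in> cells X" "cell_dim X z < i" for z
      using subsetD[OF P(3)] that by (simp only: mem_skeleton_iff)
    ultimately have eq1: "skeleton X (int i - 1) \<union>
        {z \<in> cells_of X (cells X) i. assignment_of X i (P2, P1) z} = P1"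
      by (auto simp: assignment_of_def cells_of_def mem_skeleton_iff)
    show "(skeleton X (int i) \<union> {z \<in> cells_of X (cells X) (Suc i). assignment_of X i P z},
      skeleton X (int i - 1) \<union> {z \<in> cells_of X (cells X) i. assignment_of X i P z}) = P"
      unfolding P12 eq1 eq2 ..
  qed
next
  case 2
  show ?case
    by (auto simp: assignment_of_def percolation_sites_def cells_of_def mem_skeleton_iff fun_eq_iff)
next
  case 3
  show ?case
  proof (rule image_subsetI)
    fix P assume "P \<in> percolation_pairs X i"
    moreover obtain P2 P1 where "P = (P2, P1)" by (cases P)
    ultimately show "assignment_of X i P \<in> {w. {z. w z} \<subseteq> percolation_sites X i}"
      using percolation_pair_cells(3,4)[of P2 P1 X i]
      by (auto simp: assignment_of_def percolation_sites_def)
  qed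
next
  case 4
  show ?case
    by (auto simp: mem_percolation_pairs_iff[OF assms] cells_of_def skeleton_def simp del: of_nat_Suc)
qed

lemma bernoulli_weight_eq_prod:
  assumes "finite (cells X)" "P \<subseteq> cells X"
  shows "bernoulli_weight X j p P = (\<Prod>z\<in>cells_of X (cells X) j. if z \<in> P then p else 1 - p)"
proof -
  let ?J = "cells_of X (cells X) j"
  have "finite ?J" using assms(1) by (simp add: cells_of_def)
  have "?J \<inter> P = cells_of X P j" "?J \<inter> - P = ?J - cells_of X P j" "cells_of X P j \<subseteq> ?J"
    using assms(2) by (auto simp: cells_of_def)
  moreover from this(3) \<open>finite ?J\<close> have "finite (cells_of X P j)"
    by (rule finite_subset)
  ultimately show ?thesis
    using \<open>finite ?J\<close> by (simp add: bernoulli_weight_def prod.If_cases card_Diff_subset)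
qed

lemma bernoulli_percolation_eq:
  "bernoulli_percolation X i p2 p1 = Pi_pmf (percolation_sites X i) False
     (\<lambda>z. bernoulli_pmf (site_probability X i p2 p1 z))"
  by (simp add: bernoulli_percolation_def percolation_sites_def site_probability_def)

text \<open>
  The second part is the hypothesis on the odds in the comparison from below; there it
  holds with equality, and it would fail for any larger probability on the left.
\<close>

lemma reduced_probability:
  fixes p t :: real
  assumes "p \<in> {0..1}" "1 \<le> t"
  shows "p / (t * (1 - p) + p) \<in> {0..1}"
    and "t * (p / (t * (1 - p) + p) * (1 - p)) = (1 - p / (t * (1 - p) + p)) * p"
proof -
  have "0 \<le> (t - 1) * (1 - p)"
    using assms by (intro mult_nonneg_nonneg) auto
  then have "1 \<le> t * (1 - p) + p"
    by (simp add: algebra_simps)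
  moreover have "0 \<le> t * (1 - p)"
    using assms by simp
  ultimately show "p / (t * (1 - p) + p) \<in> {0..1}"
    using assms by (simp add: divide_le_eq_1)
  show "t * (p / (t * (1 - p) + p) * (1 - p)) = (1 - p / (t * (1 - p) + p)) * p"
    using \<open>1 \<le> t * (1 - p) + p\<close> by (simp add: field_simps)
qed

context
  fixes X :: "('a, 'c) cell_complex" and q i :: nat
  assumes X: "finite_cell_complex X" and q: "prime q"
begin

definition cocycle_count :: "('c \<Rightarrow> bool) \<Rightarrow> nat" where
  "cocycle_count w = card (modular_solutions (int q) (cells_of X (cells X) i)
     (cochain_constraint X i) {z. w z})"

lemma finite_cells: "finite (cells X)"
  using X unfolding finite_cell_complex_def by (elim conjE)

lemma finite_percolation_sites: "finite (percolation_sites X i)"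
  using finite_cells by (simp add: percolation_sites_def cells_of_def)

lemma q_gt_1: "1 < q"
  using q by (rule prime_gt_1_nat)

lemma finite_cells_of: "finite (cells_of X (cells X) j)"
  using finite_cells by (simp add: cells_of_def)

lemma cocycle_count_ge_1: "1 \<le> cocycle_count w"
proof -
  let ?L = "modular_solutions (int q) (cells_of X (cells X) i) (cochain_constraint X i) {z. w z}"
  have "(\<lambda>c\<in>cells_of X (cells X) i. 0) \<in> ?L"
    using q_gt_1 by (intro zero_modular_solution) simp
  moreover have "finite ?L"
    using finite_cells_of by (rule finite_modular_solutions)
  ultimately have "0 < card ?L"
    unfolding card_gt_0_iff by blast
  then show ?thesis by (simp add: cocycle_count_def)
qed

lemma cocycle_count_antimono:
  assumes "v \<le> w"
  shows "cocycle_count w \<le> cocycle_count v"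
proof -
  have "{z. v z} \<subseteq> {z. w z}" using assms by (auto simp: le_fun_def)
  then show ?thesis
    unfolding cocycle_count_def
    by (intro card_mono finite_modular_solutions modular_solutions_anti_mono finite_cells_of)
qed

lemma cocycle_count_supermodular:
  "cocycle_count a * cocycle_count b \<le> cocycle_count (inf a b) * cocycle_count (sup a b)"
proof -
  have inf: "{z. inf a b z} = {z. a z} \<inter> {z. b z}" and sup: "{z. sup a b z} = {z. a z} \<union> {z. b z}"
    by auto
  show ?thesis
    unfolding cocycle_count_def inf sup
    by (rule card_modular_solutions_supermodular[OF finite_cells_of]) (use q_gt_1 in simp)
qed

lemma cocycle_count_le_sup:
  assumes "{z. a z} \<subseteq> S" "finite S"
  shows "cocycle_count b \<le> q ^ card {z \<in> S. a z \<and> \<not> b z} * cocycle_count (sup a b)"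
proof -
  have sup: "{z. sup a b z} = {z. a z} \<union> {z. b z}"
    and diff: "{z \<in> S. a z \<and> \<not> b z} = {z. a z} - {z. b z}"
    and nat: "q = nat (int q)"
    using assms(1) by auto
  have "finite {z. a z}" using assms by (rule finite_subset)
  then have "cocycle_count b \<le> nat (int q) ^ card ({z. a z} - {z. b z}) * cocycle_count (sup a b)"
    unfolding cocycle_count_def sup
    by (intro card_modular_solutions_union[OF finite_cells_of]) (use q_gt_1 in simp)
  then show ?thesis
    unfolding diff nat_int .
qed

lemma coupled_weight_eq:
  assumes "p2 \<in> {0..1}" "p1 \<in> {0..1}" and P: "P \<in> percolation_pairs X i"
  defines "w \<equiv> assignment_of X i P"
  shows "coupled_weight X q i p2 p1 P =
    pmf (bernoulli_percolation X i p2 p1) w * real (cocycle_count w)"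
proof -
  obtain P2 P1 where P12: "P = (P2, P1)" by (cases P)
  note P' = P[unfolded P12]
  let ?J2 = "cells_of X (cells X) (Suc i)" and ?J1 = "cells_of X (cells X) i"
  have fin: "finite ?J2" "finite ?J1" using finite_cells by (simp_all add: cells_of_def)
  have sub: "P2 \<subseteq> cells X" "P1 \<subseteq> cells X"
    using P' by (auto simp: percolation_pairs_def percolation_subcomplex_def subcomplex_def)
  have w2: "w z \<longleftrightarrow> z \<in> P2" if "z \<in> ?J2" for z
    using that by (auto simp: w_def P12 assignment_of_def cells_of_def)
  have w1: "w z \<longleftrightarrow> z \<in> P1" if "z \<in> ?J1" for z
    using that by (auto simp: w_def P12 assignment_of_def cells_of_def)
  have off: "\<not> w z" if "z \<notin> ?J2 \<union> ?J1" for z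
    using that percolation_pair_cells(3,4)[OF P'] by (auto simp: w_def P12 assignment_of_def)
  have disj: "?J2 \<inter> ?J1 = {}" by (auto simp: cells_of_def)
  have "pmf (bernoulli_percolation X i p2 p1) w =
      (\<Prod>z\<in>?J2 \<union> ?J1. pmf (bernoulli_pmf (if cell_dim X z = Suc i then p2 else p1)) (w z))"
    unfolding bernoulli_percolation_def using fin off by (simp add: pmf_Pi)
  also have "\<dots> = (\<Prod>z\<in>?J2. pmf (bernoulli_pmf (if cell_dim X z = Suc i then p2 else p1)) (w z)) *
      (\<Prod>z\<in>?J1. pmf (bernoulli_pmf (if cell_dim X z = Suc i then p2 else p1)) (w z))"
    by (rule prod.union_disjoint[OF fin disj])
  also have "(\<Prod>z\<in>?J2. pmf (bernoulli_pmf (if cell_dim X z = Suc i then p2 else p1)) (w z)) =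
      bernoulli_weight X (Suc i) p2 P2"
    unfolding bernoulli_weight_eq_prod[OF finite_cells sub(1)]
    using w2 assms(1) by (intro prod.cong) (auto simp: cells_of_def)
  also have "(\<Prod>z\<in>?J1. pmf (bernoulli_pmf (if cell_dim X z = Suc i then p2 else p1)) (w z)) =
      bernoulli_weight X i p1 P1"
    unfolding bernoulli_weight_eq_prod[OF finite_cells sub(2)]
    using w1 assms(2) by (intro prod.cong) (auto simp: cells_of_def)
  finally have "pmf (bernoulli_percolation X i p2 p1) w =
      bernoulli_weight X (Suc i) p2 P2 * bernoulli_weight X i p1 P1" .
  moreover have "{z. w z} = cells_of X P2 (Suc i) \<union> cells_of X P1 i"
    by (auto simp: w_def P12 assignment_of_def)
  ultimately show ?thesis
    by (simp add: coupled_weight_def P12 cocycle_count_def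
        order_relative_cohomology[OF q_gt_1 finite_cells P'] card_cocycles[OF q_gt_1 finite_cells P'])
qed

text \<open>
  The normalising constant is positive even if a probability is 0 or 1: every \<open>cocycle_count\<close> is
  at least 1, so the total weight is at least the total Bernoulli mass.
\<close>

lemma pmf_coupled_percolation:
  assumes p: "p2 \<in> {0..1}" "p1 \<in> {0..1}"
  obtains Z where "0 < Z" "\<And>w. pmf (coupled_percolation X q i p2 p1) w =
    pmf (bernoulli_percolation X i p2 p1) w * real (cocycle_count w) / Z"
proof
  define \<Omega> where "\<Omega> = {w. {z. w z} \<subseteq> percolation_sites X i}"
  define B where "B = bernoulli_percolation X i p2 p1"
  let ?f = "assignment_of X i" and ?pairs = "percolation_pairs X i"
  let ?u = "coupled_weight X q i p2 p1"
  define Z where "Z = sum ?u ?pairs"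
  have bij: "bij_betw ?f ?pairs \<Omega>"
    unfolding \<Omega>_def by (rule bij_betw_assignment_of[OF X])
  have "\<Omega> \<subseteq> (\<lambda>A z. z \<in> A) ` Pow (percolation_sites X i)"
    by (auto simp: \<Omega>_def image_iff intro!: bexI[of _ "Collect _"])
  then have "finite \<Omega>"
    using finite_percolation_sites by (auto intro: finite_subset)
  then have "finite ?pairs"
    using bij by (simp add: bij_betw_finite)
  have u: "?u P = pmf B (?f P) * real (cocycle_count (?f P))" if "P \<in> ?pairs" for P
    unfolding B_def by (rule coupled_weight_eq[OF p that])
  have B0: "pmf B w = 0" if "w \<notin> \<Omega>" for w
    using that finite_percolation_sites
    by (auto simp: \<Omega>_def B_def bernoulli_percolation_def percolation_sites_def pmf_Pi)
  have "set_pmf B \<subseteq> \<Omega>"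
    using B0 by (meson set_pmf_iff subsetI)
  then have "1 = sum (pmf B) \<Omega>"
    using \<open>finite \<Omega>\<close> by (intro sum_pmf_eq_1[symmetric])
  also have "\<dots> = (\<Sum>P\<in>?pairs. pmf B (?f P))"
    using bij by (rule sum.reindex_bij_betw[symmetric])
  also have "\<dots> \<le> Z"
    unfolding Z_def
  proof (rule sum_mono)
    fix P assume "P \<in> ?pairs"
    then show "pmf B (?f P) \<le> ?u P"
      using cocycle_count_ge_1[of "?f P"] by (simp add: u mult_le_cancel_left1)
  qed
  finally show "0 < Z" by simp
  define N where "N = coupled_percolation_pairs X q i p2 p1"
  have pmf_N: "pmf N P = (if P \<in> ?pairs then ?u P / Z else 0)" for P
    unfolding N_def coupled_percolation_pairs_def Z_def[symmetric]
  proof (rule pmf_embed_pmf)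
    show "0 \<le> (if P \<in> ?pairs then ?u P / Z else 0)" for P
      using \<open>0 < Z\<close> by (simp add: u)
    have "(\<integral>\<^sup>+ P. ennreal (if P \<in> ?pairs then ?u P / Z else 0) \<partial>count_space UNIV) =
        (\<Sum>P\<in>?pairs. ennreal (if P \<in> ?pairs then ?u P / Z else 0))"
      using \<open>finite ?pairs\<close> by (intro nn_integral_count_space') auto
    also have "\<dots> = (\<Sum>P\<in>?pairs. ennreal (?u P / Z))"
      by (intro sum.cong) auto
    also have "\<dots> = ennreal (\<Sum>P\<in>?pairs. ?u P / Z)"
      using \<open>0 < Z\<close> by (intro sum_ennreal) (simp add: u)
    also have "(\<Sum>P\<in>?pairs. ?u P / Z) = 1"
      using \<open>0 < Z\<close> by (simp add: Z_def flip: sum_divide_distrib)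
    finally show "(\<integral>\<^sup>+ P. ennreal (if P \<in> ?pairs then ?u P / Z else 0) \<partial>count_space UNIV) = 1"
      by simp
  qed
  show "pmf (coupled_percolation X q i p2 p1) w =
      pmf (bernoulli_percolation X i p2 p1) w * real (cocycle_count w) / Z" for w
  proof -
    have law: "pmf (coupled_percolation X q i p2 p1) w = measure N (?f -` {w})"
      by (simp add: coupled_percolation_def N_def pmf_map)
    have supp: "set_pmf N \<subseteq> ?pairs"
      by (auto simp: set_pmf_iff pmf_N split: if_splits)
    show ?thesis
    proof (cases "w \<in> \<Omega>")
      case True
      then obtain P where P: "P \<in> ?pairs" "?f P = w"
        using bij by (auto simp: bij_betw_def)
      have "?f -` {w} \<inter> set_pmf N = {P} \<inter> set_pmf N"
        using P supp bij_betw_imp_inj_on[OF bij] by (auto dest: inj_onD)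
      then have "measure N (?f -` {w}) = measure N {P}"
        using measure_Int_set_pmf[of N "?f -` {w}"] measure_Int_set_pmf[of N "{P}"] by simp
      then show ?thesis
        using P by (simp add: law measure_pmf_single pmf_N u B_def)
    next
      case False
      then have "?f -` {w} \<inter> set_pmf N = {}"
        using supp bij by (auto simp: bij_betw_def)
      then have "measure N (?f -` {w}) = 0"
        using measure_Int_set_pmf[of N "?f -` {w}"] by simp
      then show ?thesis
        using B0[OF False] by (simp add: law B_def)
    qed
  qed
qed

section \<open>Stochastic comparison\<close>

lemma bernoulli_dominates_coupled:
  assumes p: "p2 \<in> {0..1}" "p1 \<in> {0..1}"
  shows "stochastically_dominates (bernoulli_percolation X i p2 p1) (coupled_percolation X q i p2 p1)"
proof -
  obtain Z where Z: "0 < Z" and law: "\<And>w. pmf (coupled_percolation X q i p2 p1) w =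
      pmf (bernoulli_percolation X i p2 p1) w * real (cocycle_count w) / Z"
    by (rule pmf_coupled_percolation[OF p]) (rule that)
  show ?thesis
  proof (rule stochastically_dominates_reweighted[where S = "percolation_sites X i" and c = "1" and
        ?Z1.0 = "Z" and ?Z2.0 = "1" and
        r = "site_probability X i p2 p1" and s = "site_probability X i p2 p1" and
        ?m1.0 = "\<lambda>w. real (cocycle_count w)" and ?m2.0 = "\<lambda>_. 1"])
    show "finite (percolation_sites X i)" by (rule finite_percolation_sites)
    show "0 \<le> (1 :: real)" "0 < (1 :: real)" by simp_all
    show "0 < Z" by (rule Z)
    show "site_probability X i p2 p1 z \<in> {0..1}" for z
      using p by (simp add: site_probability_def)
    then show "site_probability X i p2 p1 z \<in> {0..1}" for z .
    show "1 * (site_probability X i p2 p1 z * (1 - site_probability X i p2 p1 z)) \<le>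
        (1 - site_probability X i p2 p1 z) * site_probability X i p2 p1 z" for z
      by simp
    show "pmf (coupled_percolation X q i p2 p1) w =
        pmf (Pi_pmf (percolation_sites X i) False (\<lambda>z. bernoulli_pmf (site_probability X i p2 p1 z))) w *
        real (cocycle_count w) / Z" for w
      by (simp only: law bernoulli_percolation_eq)
    show "pmf (bernoulli_percolation X i p2 p1) w =
        pmf (Pi_pmf (percolation_sites X i) False (\<lambda>z. bernoulli_pmf (site_probability X i p2 p1 z))) w *
        1 / 1" for w
      by (simp add: bernoulli_percolation_eq)
    show "0 \<le> real (cocycle_count w)" "0 \<le> (1 :: real)" for w by simp_all
    show "real (cocycle_count a) * 1 \<le> 1 ^ card {z \<in> percolation_sites X i. a z \<and> \<not> b z} *
        (real (cocycle_count (inf a b)) * 1)" for a b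
      using cocycle_count_antimono[of "inf a b" a] by simp
  qed
qed

lemma coupled_dominates_bernoulli:
  assumes p: "p2 \<in> {0..1}" "p1 \<in> {0..1}"
  shows "stochastically_dominates (coupled_percolation X q i p2 p1)
    (bernoulli_percolation X i (p2 / (real q * (1 - p2) + p2)) (p1 / (real q * (1 - p1) + p1)))"
proof -
  obtain Z where Z: "0 < Z" and law: "\<And>w. pmf (coupled_percolation X q i p2 p1) w =
      pmf (bernoulli_percolation X i p2 p1) w * real (cocycle_count w) / Z"
    by (rule pmf_coupled_percolation[OF p]) (rule that)
  define r where "r = site_probability X i
    (p2 / (real q * (1 - p2) + p2)) (p1 / (real q * (1 - p1) + p1))"
  define s where "s = site_probability X i p2 p1"
  have q1: "1 \<le> real q" using q_gt_1 by simp
  show ?thesis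
  proof (rule stochastically_dominates_reweighted[where S = "percolation_sites X i" and c = "real q" and
        ?Z1.0 = "1" and ?Z2.0 = "Z" and r = "r" and s = "s" and
        ?m1.0 = "\<lambda>_. 1" and ?m2.0 = "\<lambda>w. real (cocycle_count w)"])
    show "finite (percolation_sites X i)" by (rule finite_percolation_sites)
    show "0 \<le> real q" "0 < (1 :: real)" by simp_all
    show "0 < Z" by (rule Z)
    show "r z \<in> {0..1}" for z
      using reduced_probability(1)[OF p(1) q1] reduced_probability(1)[OF p(2) q1]
      by (simp only: r_def site_probability_def split: if_split) simp
    show "s z \<in> {0..1}" for z
      using p by (simp add: s_def site_probability_def)
    show "real q * (r z * (1 - s z)) \<le> (1 - r z) * s z" for z
      unfolding r_def s_def site_probability_def
      by (cases "cell_dim X z = Suc i")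
        (simp_all only: simp_thms if_True if_False reduced_probability(2)[OF p(1) q1]
          reduced_probability(2)[OF p(2) q1] order_refl)
    show "pmf (bernoulli_percolation X i
          (p2 / (real q * (1 - p2) + p2)) (p1 / (real q * (1 - p1) + p1))) w =
        pmf (Pi_pmf (percolation_sites X i) False (\<lambda>z. bernoulli_pmf (r z))) w * 1 / 1" for w
      by (simp add: bernoulli_percolation_eq r_def)
    show "pmf (coupled_percolation X q i p2 p1) w =
        pmf (Pi_pmf (percolation_sites X i) False (\<lambda>z. bernoulli_pmf (s z))) w *
        real (cocycle_count w) / Z" for w
      by (simp only: law bernoulli_percolation_eq s_def)
    show "0 \<le> real (cocycle_count w)" "0 \<le> (1 :: real)" for w by simp_all
    show "1 * real (cocycle_count b) \<le>
        real q ^ card {z \<in> percolation_sites X i. a z \<and> \<not> b z} * (1 * real (cocycle_count (sup a b)))"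
      if "{z. a z} \<subseteq> percolation_sites X i" for a b
      using of_nat_mono[OF cocycle_count_le_sup[OF that finite_percolation_sites], where 'a = real]
      by simp
  qed
qed

lemma coupled_percolation_mono:
  assumes p: "p2 \<in> {0..1}" "p1 \<in> {0..1}" and p': "p2' \<in> {0..1}" "p1' \<in> {0..1}"
    and le: "p2 \<le> p2'" "p1 \<le> p1'"
  shows "stochastically_dominates (coupled_percolation X q i p2' p1') (coupled_percolation X q i p2 p1)"
proof -
  obtain Z where Z: "0 < Z" and law: "\<And>w. pmf (coupled_percolation X q i p2 p1) w =
      pmf (bernoulli_percolation X i p2 p1) w * real (cocycle_count w) / Z"
    by (rule pmf_coupled_percolation[OF p]) (rule that)
  obtain Z' where Z': "0 < Z'" and law': "\<And>w. pmf (coupled_percolation X q i p2' p1') w =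
      pmf (bernoulli_percolation X i p2' p1') w * real (cocycle_count w) / Z'"
    by (rule pmf_coupled_percolation[OF p']) (rule that)
  show ?thesis
  proof (rule stochastically_dominates_reweighted[where S = "percolation_sites X i" and c = "1" and
        ?Z1.0 = "Z" and ?Z2.0 = "Z'" and
        r = "site_probability X i p2 p1" and s = "site_probability X i p2' p1'" and
        ?m1.0 = "\<lambda>w. real (cocycle_count w)" and ?m2.0 = "\<lambda>w. real (cocycle_count w)"])
    show "finite (percolation_sites X i)" by (rule finite_percolation_sites)
    show "0 \<le> (1 :: real)" by simp
    show "0 < Z" "0 < Z'" by (rule Z, rule Z')
    show "site_probability X i p2 p1 z \<in> {0..1}" "site_probability X i p2' p1' z \<in> {0..1}" for z
      using p p' by (simp_all add: site_probability_def)
    show "1 * (site_probability X i p2 p1 z * (1 - site_probability X i p2' p1' z)) \<le>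
        (1 - site_probability X i p2 p1 z) * site_probability X i p2' p1' z" for z
      using le by (simp add: site_probability_def algebra_simps)
    show "pmf (coupled_percolation X q i p2 p1) w =
        pmf (Pi_pmf (percolation_sites X i) False (\<lambda>z. bernoulli_pmf (site_probability X i p2 p1 z))) w *
        real (cocycle_count w) / Z" for w
      by (simp only: law bernoulli_percolation_eq)
    show "pmf (coupled_percolation X q i p2' p1') w =
        pmf (Pi_pmf (percolation_sites X i) False (\<lambda>z. bernoulli_pmf (site_probability X i p2' p1' z))) w *
        real (cocycle_count w) / Z'" for w
      by (simp only: law' bernoulli_percolation_eq)
    show "0 \<le> real (cocycle_count w)" "0 \<le> real (cocycle_count w)" for w by simp_all
    show "real (cocycle_count a) * real (cocycle_count b) \<le>
        1 ^ card {z \<in> percolation_sites X i. a z \<and> \<not> b z} *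
        (real (cocycle_count (inf a b)) * real (cocycle_count (sup a b)))" for a b
      using of_nat_mono[OF cocycle_count_supermodular[of a b], where 'a = real] by simp
  qed
qed

end

theorem theorem13:
  fixes X :: "('a, 'c) cell_complex" and q i :: nat
  assumes "finite_cell_complex X" and "prime q"
  shows "(\<forall>p2\<in>{0..1}. \<forall>p1\<in>{0..1}.
            stochastically_dominates
              (bernoulli_percolation X i p2 p1)
              (coupled_percolation X q i p2 p1) \<and>
            stochastically_dominates
              (coupled_percolation X q i p2 p1)
              (bernoulli_percolation X i
                 (p2 / (real q * (1 - p2) + p2)) (p1 / (real q * (1 - p1) + p1)))) \<and>
         (\<forall>p2\<in>{0..1}. \<forall>p2'\<in>{0..1}. \<forall>p1\<in>{0..1}. p2 \<le> p2' \<longrightarrow>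
            stochastically_dominates
              (coupled_percolation X q i p2' p1) (coupled_percolation X q i p2 p1)) \<and>
         (\<forall>p2\<in>{0..1}. \<forall>p1\<in>{0..1}. \<forall>p1'\<in>{0..1}. p1 \<le> p1' \<longrightarrow>
            stochastically_dominates
              (coupled_percolation X q i p2 p1') (coupled_percolation X q i p2 p1))"
  using bernoulli_dominates_coupled[OF assms] coupled_dominates_bernoulli[OF assms]
  by (auto intro!: coupled_percolation_mono[OF assms])

end
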